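(* Let $M'$ be a lightlike hypersurface of a pseudo-Riemannian manifold $(M,g)$ with an integrable screen distribution $S(TM')$. If $(M,g,\eta,\nabla)$ and $(M,\widetilde g,\eta,\widetilde\nabla)$ are conformal-projective equivalent semi-Weyl manifolds admitting torsion (SWMT), then the induced structures $(g',\eta',\bar\nabla)$ and $(\widetilde g',\eta',\bar{\widetilde\nabla})$ on $S(TM')$ are conformal-projective equivalent, too.
   Context: For an affine connection $\nabla$ (possibly with torsion) on a pseudo-Riemannian manifold $(M,g)$ and a $1$-form $\eta$, put $T^\nabla(X,Y)=\nabla_XY-\nabla_YX-[X,Y]$. $(M,g,\eta,\nabla)$ is a SWMT if $(\nabla_Xg)(Y,Z)+\eta(X)g(Y,Z)=(\nabla_Yg)(X,Z)+\eta(Y)g(X,Z)-g(T^\nabla(X,Y),Z)$ for all vector fields $X,Y,Z$. $(M,g,\eta,\nabla)$ and $(M,\widetilde g,\eta,\widetilde\nabla)$ are conformal-projective equivalent if there are smooth functions $\phi,\psi$ on $M$ with $\widetilde g=e^{\phi+\psi}g$ and $\widetilde\nabla_XY=\nabla_XY+d\phi(X)Y+d\phi(Y)X-g(X,Y)\,\mathrm{grad}_g\psi$ for all vector fields $X,Y$. Here $\dim M=n+2$ and the index of negativity of $g$ is greater than $0$ and less than $n+2$. A smooth hypersurface $M'$ is lightlike if $g'=g|_{TM'\times TM'}$ is degenerate; its radical distribution $Rad(TM')=\{\zeta: g'(\zeta,X)=0\ \text{for all } X\text{ tangent to }M'\}$ has rank $1$ (and is the same for $g'$ and $\widetilde g'$).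 A screen distribution $S(TM')$ is a complementary subbundle of $Rad(TM')$ in $TM'$; it is non-degenerate, so $TM|_{M'}=S(TM')\oplus_\perp(S(TM'))^\perp$. The same screen distribution is used for $g$ and $\widetilde g$. Integrable means closed under the Lie bracket. The structure on $S(TM')$ induced by $(g,\eta,\nabla)$ is $(g',\eta',\bar\nabla)$, where $g',\eta'$ are the restrictions of $g,\eta$ to $S(TM')$ and $\bar\nabla_XY$ is the $S(TM')$-component of $\nabla_XY$ in the orthogonal decomposition $TM|_{M'}=S(TM')\oplus_\perp(S(TM'))^\perp$, for $X,Y\in\Gamma^\infty(S(TM'))$; similarly $(\widetilde g',\eta',\bar{\widetilde\nabla})$ is induced by $(\widetilde g,\eta,\widetilde\nabla)$. Conformal-projective equivalence of the induced structures on $S(TM')$ means: there are smooth functions $\phi',\psi'$ on $M'$ such that on $S(TM')$, $\widetilde g'=e^{\phi'+\psi'}g'$ and $\bar{\widetilde\nabla}_XY=\bar\nabla_XY+d\phi'(X)Y+d\phi'(Y)X-g'(X,Y)\bar\nabla\psi'$ for all $X,Y\in\Gamma^\infty(S(TM'))$, where $\bar\nabla\psi'\in\Gamma^\infty(S(TM'))$ is the gradient along $S(TM')$, determined by $g'(\bar\nabla\psi',X)=d\psi'(X)$ for all $X\in\Gamma^\infty(S(TM'))$. *)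

theory Defs
  imports "HOL-Analysis.Analysis" "HOL-Library.Function_Algebras"
begin

instantiation "fun" :: (type, real_vector) real_vector
begin

definition scaleR_fun :: "real \<Rightarrow> ('a \<Rightarrow> 'b) \<Rightarrow> 'a \<Rightarrow> 'b"
  where "scaleR_fun c f = (\<lambda>x. c *\<^sub>R f x)"

instance
  by standard (auto simp: scaleR_fun_def fun_eq_iff algebra_simps)

end


section \<open>Smooth manifolds\<close>

text \<open>All sets \<open>S\<close> below are open. In finite dimension, iterating directional derivatives
  in all directions gives the usual classes \<open>C\<^sup>k\<close>.\<close>

primrec Ck_on :: "nat \<Rightarrow> 'e::real_normed_vector set \<Rightarrow> ('e \<Rightarrow> 'f::real_normed_vector) \<Rightarrow> bool"
  where
    "Ck_on 0 S f \<longleftrightarrow> continuous_on S f"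
  | "Ck_on (Suc k) S f \<longleftrightarrow>
       (\<forall>x\<in>S. f differentiable (at x)) \<and>
       (\<forall>v. Ck_on k S (\<lambda>x. frechet_derivative f (at x) v))"

definition smooth_on :: "'e::real_normed_vector set \<Rightarrow> ('e \<Rightarrow> 'f::real_normed_vector) \<Rightarrow> bool"
  where "smooth_on S f \<longleftrightarrow> (\<forall>k. Ck_on k S f)"

type_synonym ('a, 'e) chart = "'a set \<times> ('a \<Rightarrow> 'e)"
type_synonym ('a, 'e) atlas = "('a, 'e) chart set"

text \<open>The values of \<open>\<phi>\<close> outside \<open>U\<close> play no role in a chart \<open>(U, \<phi>)\<close>.\<close>

definition is_chart :: "('a::topological_space, 'e::euclidean_space) chart \<Rightarrow> bool"
  where "is_chart = (\<lambda>(U, \<phi>). open U \<and> open (\<phi> ` U) \<and>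
           homeomorphism U (\<phi> ` U) \<phi> (inv_into U \<phi>))"

definition compatible_charts ::
    "('a::topological_space, 'e::euclidean_space) chart \<Rightarrow> ('a, 'e) chart \<Rightarrow> bool"
  where "compatible_charts = (\<lambda>(U, \<phi>) (V, \<psi>).
           smooth_on (\<phi> ` (U \<inter> V)) (\<psi> \<circ> inv_into U \<phi>) \<and>
           smooth_on (\<psi> ` (U \<inter> V)) (\<phi> \<circ> inv_into V \<psi>))"

text \<open>A smooth manifold is a (Hausdorff, second countable) type with a maximal smooth atlas.\<close>

definition smooth_structure ::
    "('a::{t2_space, second_countable_topology}, 'e::euclidean_space) atlas \<Rightarrow> bool"
  where "smooth_structure A \<longleftrightarrow>
    (\<forall>c\<in>A. is_chart c) \<and> (\<Union>c\<in>A. fst c) = UNIV \<and>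
    (\<forall>c\<in>A. \<forall>d\<in>A. compatible_charts c d) \<and>
    (\<forall>c. is_chart c \<and> (\<forall>d\<in>A. compatible_charts c d) \<longrightarrow> c \<in> A)"

definition smooth_fun ::
    "('a::topological_space, 'e::euclidean_space) atlas \<Rightarrow> ('a \<Rightarrow> real) \<Rightarrow> bool"
  where "smooth_fun A f \<longleftrightarrow> (\<forall>(U, \<phi>)\<in>A. smooth_on (\<phi> ` U) (f \<circ> inv_into U \<phi>))"

definition smooth_map ::
    "('b::topological_space, 'h::euclidean_space) atlas \<Rightarrow>
     ('a::topological_space, 'e::euclidean_space) atlas \<Rightarrow> ('b \<Rightarrow> 'a) \<Rightarrow> bool"
  where "smooth_map B A F \<longleftrightarrow> continuous_on UNIV F \<and>
    (\<forall>(V, \<theta>)\<in>B. \<forall>(U, \<phi>)\<in>A.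
       smooth_on (\<theta> ` (V \<inter> F -` U)) (\<phi> \<circ> F \<circ> inv_into V \<theta>))"


section \<open>Tangent vectors and vector fields\<close>

text \<open>Tangent vectors at \<open>p\<close> are the derivations at \<open>p\<close> of the algebra of smooth functions,
  extended by \<open>0\<close> to all functions so that equality of tangent vectors is equality in HOL.
  Hence \<open>df(v)\<close> is simply \<open>v f\<close>, and \<open>X p f\<close> is the value at \<open>p\<close> of the
  derivative of \<open>f\<close> along the vector field \<open>X\<close>.\<close>

type_synonym 'a tvec = "('a \<Rightarrow> real) \<Rightarrow> real"
type_synonym 'a vfield = "'a \<Rightarrow> 'a tvec"

definition tangent ::
    "('a::topological_space, 'e::euclidean_space) atlas \<Rightarrow> 'a \<Rightarrow> 'a tvec set"
  where "tangent A p = {v.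
    (\<forall>f. \<not> smooth_fun A f \<longrightarrow> v f = 0) \<and>
    (\<forall>f g. smooth_fun A f \<and> smooth_fun A g \<longrightarrow> v (\<lambda>x. f x + g x) = v f + v g) \<and>
    (\<forall>c f. smooth_fun A f \<longrightarrow> v (\<lambda>x. c * f x) = c * v f) \<and>
    (\<forall>f g. smooth_fun A f \<and> smooth_fun A g \<longrightarrow>
       v (\<lambda>x. f x * g x) = f p * v g + g p * v f)}"

definition vector_fields ::
    "('a::topological_space, 'e::euclidean_space) atlas \<Rightarrow> 'a vfield set"
  where "vector_fields A = {X. (\<forall>p. X p \<in> tangent A p) \<and>
           (\<forall>f. smooth_fun A f \<longrightarrow> smooth_fun A (\<lambda>p. X p f))}"

definition sections ::
    "('a::topological_space, 'e::euclidean_space) atlas \<Rightarrow> ('a \<Rightarrow> 'a tvec set) \<Rightarrow>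
     'a vfield set"
  where "sections A E = {X \<in> vector_fields A. \<forall>p. X p \<in> E p}"

definition lie_bracket :: "'a vfield \<Rightarrow> 'a vfield \<Rightarrow> 'a vfield"
  where "lie_bracket X Y = (\<lambda>p f. X p (\<lambda>q. Y q f) - Y p (\<lambda>q. X q f))"

definition pushforward ::
    "('a::topological_space, 'e::euclidean_space) atlas \<Rightarrow> ('b \<Rightarrow> 'a) \<Rightarrow> 'b tvec \<Rightarrow> 'a tvec"
  where "pushforward A F v = (\<lambda>f. if smooth_fun A f then v (f \<circ> F) else 0)"


section \<open>Metrics, one-forms, connections\<close>

type_synonym 'a metric = "'a \<Rightarrow> 'a tvec \<Rightarrow> 'a tvec \<Rightarrow> real"
type_synonym 'a form = "'a \<Rightarrow> 'a tvec \<Rightarrow> real"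
type_synonym 'a connection = "'a vfield \<Rightarrow> 'a vfield \<Rightarrow> 'a vfield"

definition pseudo_riemannian ::
    "('a::topological_space, 'e::euclidean_space) atlas \<Rightarrow> 'a metric \<Rightarrow> bool"
  where "pseudo_riemannian A g \<longleftrightarrow>
    (\<forall>p. \<forall>u\<in>tangent A p. \<forall>v\<in>tangent A p. g p u v = g p v u) \<and>
    (\<forall>p. \<forall>u\<in>tangent A p. \<forall>v\<in>tangent A p. \<forall>w\<in>tangent A p.
       g p (u + v) w = g p u w + g p v w) \<and>
    (\<forall>p c. \<forall>u\<in>tangent A p. \<forall>w\<in>tangent A p. g p (c *\<^sub>R u) w = c * g p u w) \<and>
    (\<forall>p. \<forall>u\<in>tangent A p. (\<forall>w\<in>tangent A p. g p u w = 0) \<longrightarrow> u = 0) \<and>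
    (\<forall>X\<in>vector_fields A. \<forall>Y\<in>vector_fields A. smooth_fun A (\<lambda>p. g p (X p) (Y p)))"

definition negative_index ::
    "('a::topological_space, 'e::euclidean_space) atlas \<Rightarrow> 'a metric \<Rightarrow> 'a \<Rightarrow> nat"
  where "negative_index A g p =
    Max {dim W |W. subspace W \<and> W \<subseteq> tangent A p \<and> (\<forall>w\<in>W. w \<noteq> 0 \<longrightarrow> g p w w < 0)}"

definition one_form ::
    "('a::topological_space, 'e::euclidean_space) atlas \<Rightarrow> 'a form \<Rightarrow> bool"
  where "one_form A \<eta> \<longleftrightarrow>
    (\<forall>p. \<forall>u\<in>tangent A p. \<forall>v\<in>tangent A p. \<eta> p (u + v) = \<eta> p u + \<eta> p v) \<and>
    (\<forall>p c. \<forall>u\<in>tangent A p. \<eta> p (c *\<^sub>R u) = c * \<eta> p u) \<and>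
    (\<forall>X\<in>vector_fields A. smooth_fun A (\<lambda>p. \<eta> p (X p)))"

definition affine_connection ::
    "('a::topological_space, 'e::euclidean_space) atlas \<Rightarrow> 'a connection \<Rightarrow> bool"
  where "affine_connection A D \<longleftrightarrow>
    (\<forall>X\<in>vector_fields A. \<forall>Y\<in>vector_fields A.
       D X Y \<in> vector_fields A \<and>
       (\<forall>Z\<in>vector_fields A. D (X + Z) Y = D X Y + D Z Y \<and> D X (Y + Z) = D X Y + D X Z) \<and>
       (\<forall>f. smooth_fun A f \<longrightarrow>
          D (\<lambda>p. f p *\<^sub>R X p) Y = (\<lambda>p. f p *\<^sub>R D X Y p) \<and>
          D X (\<lambda>p. f p *\<^sub>R Y p) = (\<lambda>p. f p *\<^sub>R D X Y p + X p f *\<^sub>R Y p)))"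

definition torsion :: "'a connection \<Rightarrow> 'a vfield \<Rightarrow> 'a vfield \<Rightarrow> 'a vfield"
  where "torsion D X Y = D X Y - D Y X - lie_bracket X Y"

text \<open>\<open>metric_derivative D g X Y Z\<close> is \<open>(D\<^sub>X g)(Y, Z)\<close>.\<close>

definition metric_derivative ::
    "'a connection \<Rightarrow> 'a metric \<Rightarrow> 'a vfield \<Rightarrow> 'a vfield \<Rightarrow> 'a vfield \<Rightarrow> 'a \<Rightarrow> real"
  where "metric_derivative D g X Y Z p =
    X p (\<lambda>q. g q (Y q) (Z q)) - g p (D X Y p) (Z p) - g p (Y p) (D X Z p)"

definition SWMT ::
    "('a::topological_space, 'e::euclidean_space) atlas \<Rightarrow>
     'a metric \<times> 'a form \<times> 'a connection \<Rightarrow> bool"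
  where "SWMT A = (\<lambda>(g, \<eta>, D).
    pseudo_riemannian A g \<and> one_form A \<eta> \<and> affine_connection A D \<and>
    (\<forall>X\<in>vector_fields A. \<forall>Y\<in>vector_fields A. \<forall>Z\<in>vector_fields A. \<forall>p.
       metric_derivative D g X Y Z p + \<eta> p (X p) * g p (Y p) (Z p) =
       metric_derivative D g Y X Z p + \<eta> p (Y p) * g p (X p) (Z p)
         - g p (torsion D X Y p) (Z p)))"


section \<open>Conformal-projective equivalence\<close>

text \<open>Both notions are stated along a subbundle \<open>E\<close> of the tangent bundle:
  \<open>E = tangent A\<close> gives the notion for the manifold itself, and a screen distribution
  gives the notion for the induced structures.\<close>

definition gradient :: "('a \<Rightarrow> 'a tvec set) \<Rightarrow> 'a metric \<Rightarrow> ('a \<Rightarrow> real) \<Rightarrow> 'a vfield"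
  where "gradient E g \<psi> p = (THE v. v \<in> E p \<and> (\<forall>w\<in>E p. g p v w = w \<psi>))"

definition conf_proj_equiv ::
    "('a::topological_space, 'e::euclidean_space) atlas \<Rightarrow> ('a \<Rightarrow> 'a tvec set) \<Rightarrow>
     'a metric \<times> 'a form \<times> 'a connection \<Rightarrow>
     'a metric \<times> 'a form \<times> 'a connection \<Rightarrow> bool"
  where "conf_proj_equiv A E = (\<lambda>(g, \<eta>, D) (g2, \<eta>2, D2).
    (\<forall>p. \<forall>v\<in>E p. \<eta>2 p v = \<eta> p v) \<and>
    (\<exists>\<phi> \<psi>. smooth_fun A \<phi> \<and> smooth_fun A \<psi> \<and>
      (\<forall>p. \<forall>v\<in>E p. \<forall>w\<in>E p. g2 p v w = exp (\<phi> p + \<psi> p) * g p v w) \<and>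
      (\<forall>X\<in>sections A E. \<forall>Y\<in>sections A E. \<forall>p.
         D2 X Y p = D X Y p + X p \<phi> *\<^sub>R Y p + Y p \<phi> *\<^sub>R X p
                    - g p (X p) (Y p) *\<^sub>R gradient E g \<psi> p)))"


section \<open>Lightlike hypersurfaces and screen distributions\<close>

text \<open>A hypersurface is a manifold \<open>B\<close> with an immersion \<open>\<iota>\<close> of codimension one; a
  hypersurface given as a subset is the case where \<open>\<iota>\<close> is the inclusion. Tangent vectors
  of the hypersurface are derivations of its own algebra of smooth functions, and are
  regarded as tangent vectors of the ambient manifold through \<open>pushforward\<close>.\<close>

definition immersion ::
    "('b::topological_space, 'h::euclidean_space) atlas \<Rightarrow>
     ('a::topological_space, 'e::euclidean_space) atlas \<Rightarrow> ('b \<Rightarrow> 'a) \<Rightarrow> bool"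
  where "immersion B A \<iota> \<longleftrightarrow>
    smooth_map B A \<iota> \<and> (\<forall>q. inj_on (pushforward A \<iota>) (tangent B q))"

definition smooth_hypersurface ::
    "('b::topological_space, 'h::euclidean_space) atlas \<Rightarrow>
     ('a::topological_space, 'e::euclidean_space) atlas \<Rightarrow> ('b \<Rightarrow> 'a) \<Rightarrow> bool"
  where "smooth_hypersurface B A \<iota> \<longleftrightarrow> immersion B A \<iota> \<and> DIM('e) = DIM('h) + 1"

definition induced_metric ::
    "('a::topological_space, 'e::euclidean_space) atlas \<Rightarrow> ('b \<Rightarrow> 'a) \<Rightarrow> 'a metric \<Rightarrow> 'b metric"
  where "induced_metric A \<iota> g q v w = g (\<iota> q) (pushforward A \<iota> v) (pushforward A \<iota> w)"

definition induced_form ::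
    "('a::topological_space, 'e::euclidean_space) atlas \<Rightarrow> ('b \<Rightarrow> 'a) \<Rightarrow> 'a form \<Rightarrow> 'b form"
  where "induced_form A \<iota> \<eta> q v = \<eta> (\<iota> q) (pushforward A \<iota> v)"

definition radical ::
    "('b::topological_space, 'h::euclidean_space) atlas \<Rightarrow>
     'b metric \<Rightarrow> 'b \<Rightarrow> 'b tvec set"
  where "radical B h q = {v \<in> tangent B q. \<forall>w\<in>tangent B q. h q v w = 0}"

definition lightlike_hypersurface ::
    "('b::topological_space, 'h::euclidean_space) atlas \<Rightarrow>
     ('a::topological_space, 'e::euclidean_space) atlas \<Rightarrow> 'a metric \<Rightarrow> ('b \<Rightarrow> 'a) \<Rightarrow> bool"
  where "lightlike_hypersurface B A g \<iota> \<longleftrightarrow>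
    smooth_hypersurface B A \<iota> \<and> (\<forall>q. radical B (induced_metric A \<iota> g) q \<noteq> {0})"

text \<open>Smooth subbundles of the tangent bundle, by local frames. The frame fields are defined
  globally, which is no restriction, since a local frame can be cut off.\<close>

definition smooth_distribution ::
    "('b::topological_space, 'h::euclidean_space) atlas \<Rightarrow> ('b \<Rightarrow> 'b tvec set) \<Rightarrow> bool"
  where "smooth_distribution B S \<longleftrightarrow>
    (\<forall>q. \<exists>U k. \<exists>X :: nat \<Rightarrow> 'b vfield. open U \<and> q \<in> U \<and> (\<forall>i<k. X i \<in> vector_fields B) \<and>
       (\<forall>r\<in>U. inj_on (\<lambda>i. X i r) {..<k} \<and> independent ((\<lambda>i. X i r) ` {..<k}) \<and>
               S r = span ((\<lambda>i. X i r) ` {..<k})))"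

definition screen_distribution ::
    "('b::topological_space, 'h::euclidean_space) atlas \<Rightarrow>
     ('a::topological_space, 'e::euclidean_space) atlas \<Rightarrow> 'a metric \<Rightarrow> ('b \<Rightarrow> 'a) \<Rightarrow>
     ('b \<Rightarrow> 'b tvec set) \<Rightarrow> bool"
  where "screen_distribution B A g \<iota> S \<longleftrightarrow> smooth_distribution B S \<and>
    (\<forall>q. S q \<inter> radical B (induced_metric A \<iota> g) q = {0} \<and>
         tangent B q = {s + r |s r. s \<in> S q \<and> r \<in> radical B (induced_metric A \<iota> g) q})"

definition integrable_distribution ::
    "('b::topological_space, 'h::euclidean_space) atlas \<Rightarrow> ('b \<Rightarrow> 'b tvec set) \<Rightarrow> bool"
  where "integrable_distribution B S \<longleftrightarrow>
    (\<forall>X\<in>sections B S. \<forall>Y\<in>sections B S. lie_bracket X Y \<in> sections B S)"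


section \<open>The structure induced on the screen distribution\<close>

text \<open>For vector fields \<open>X\<close>, \<open>Y\<close> on the hypersurface, the covariant derivative of \<open>Y\<close>
  along \<open>X\<close> at \<open>q\<close> is computed from vector fields on the ambient manifold that extend
  \<open>X\<close> and \<open>Y\<close> near \<open>q\<close>. As usual, such extensions exist, and the value does not depend
  on the ones that are chosen.\<close>

definition extends_near ::
    "('a::topological_space, 'e::euclidean_space) atlas \<Rightarrow> ('b::topological_space \<Rightarrow> 'a) \<Rightarrow>
     'b \<Rightarrow> 'b vfield \<Rightarrow> 'a vfield \<Rightarrow> bool"
  where "extends_near A \<iota> q X Xe \<longleftrightarrow> Xe \<in> vector_fields A \<and>
    (\<exists>U. open U \<and> q \<in> U \<and> (\<forall>r\<in>U. Xe (\<iota> r) = pushforward A \<iota> (X r)))"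

definition derivative_along ::
    "('a::topological_space, 'e::euclidean_space) atlas \<Rightarrow> ('b::topological_space \<Rightarrow> 'a) \<Rightarrow>
     'a connection \<Rightarrow> 'b vfield \<Rightarrow> 'b vfield \<Rightarrow> 'b \<Rightarrow> 'a tvec"
  where "derivative_along A \<iota> D X Y q =
    D (SOME Xe. extends_near A \<iota> q X Xe) (SOME Ye. extends_near A \<iota> q Y Ye) (\<iota> q)"

definition screen_perp ::
    "('a::topological_space, 'e::euclidean_space) atlas \<Rightarrow> 'a metric \<Rightarrow> ('b \<Rightarrow> 'a) \<Rightarrow>
     ('b \<Rightarrow> 'b tvec set) \<Rightarrow> 'b \<Rightarrow> 'a tvec set"
  where "screen_perp A g \<iota> S q =
    {u \<in> tangent A (\<iota> q). \<forall>w\<in>S q. g (\<iota> q) u (pushforward A \<iota> w) = 0}"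

definition screen_component ::
    "('a::topological_space, 'e::euclidean_space) atlas \<Rightarrow> 'a metric \<Rightarrow> ('b \<Rightarrow> 'a) \<Rightarrow>
     ('b \<Rightarrow> 'b tvec set) \<Rightarrow> 'b \<Rightarrow> 'a tvec \<Rightarrow> 'b tvec"
  where "screen_component A g \<iota> S q u =
    (THE s. s \<in> S q \<and> (\<exists>t\<in>screen_perp A g \<iota> S q. u = pushforward A \<iota> s + t))"

definition induced_connection ::
    "('a::topological_space, 'e::euclidean_space) atlas \<Rightarrow> ('b::topological_space \<Rightarrow> 'a) \<Rightarrow>
     ('b \<Rightarrow> 'b tvec set) \<Rightarrow> 'a metric \<Rightarrow> 'a connection \<Rightarrow> 'b connection"
  where "induced_connection A \<iota> S g D X Y q =
    screen_component A g \<iota> S q (derivative_along A \<iota> D X Y q)"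

definition induced_structure ::
    "('a::topological_space, 'e::euclidean_space) atlas \<Rightarrow> ('b::topological_space \<Rightarrow> 'a) \<Rightarrow>
     ('b \<Rightarrow> 'b tvec set) \<Rightarrow> 'a metric \<times> 'a form \<times> 'a connection \<Rightarrow>
     'b metric \<times> 'b form \<times> 'b connection"
  where "induced_structure A \<iota> S = (\<lambda>(g, \<eta>, D).
    (induced_metric A \<iota> g, induced_form A \<iota> \<eta>, induced_connection A \<iota> S g D))"

end

theory Submission
  imports Defs
begin

text \<open>
  The functions \<open>\<phi>\<close>, \<open>\<psi>\<close> of the ambient equivalence are pulled back along \<open>\<iota>\<close>.
  Since \<open>g2\<close> is a multiple of \<open>g\<close>, both have the same screen component, and this component is linear,
  fixes the screen distribution and maps \<open>grad \<psi>\<close> to the gradient of \<open>\<psi> \<circ> \<iota>\<close> along it;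
  so it turns one equivalence into the other. The analytic content is that
  \<open>derivative_along\<close> only makes sense if vector fields on the hypersurface extend locally: an
  immersion has a local smooth left inverse (inverse function theorem), through which the coefficients
  of the pushed forward field in a chart are extended, and derivations are determined by their values
  on coordinates (Hadamard).
\<close>


section \<open>Calculus of smooth functions\<close>

text \<open>Two features of the encoding shape the proof. \<open>derivative_along\<close> picks its
  extensions by \<open>SOME\<close>, so the ambient identity between \<open>D2\<close> and
  \<open>D\<close> becomes available only once some extension is known to exist. Both induced
  connections then evaluate at the same chosen pair \<open>Xe\<close>, \<open>Ye\<close>, and the
  identity at \<open>\<iota> q\<close> can be projected term by term. Secondly, derivations act on
  globally defined smooth functions, so every local object (coordinates, Hadamard coefficients,
  extended fields) has to be cut off by a bump function and continued by zero. Tangent vectors are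
  elements of a function space, so the finite dimension behind this representation comes from the
  spanning coordinate vectors.\<close>

lemma Ck_on_cong:
  assumes "open S" "\<And>x. x \<in> S \<Longrightarrow> f x = g x"
  shows "Ck_on k S f \<longleftrightarrow> Ck_on k S g"
proof -
  have *: "Ck_on k S g" if "Ck_on k S f" "\<And>x. x \<in> S \<Longrightarrow> f x = g x" for k and f g :: "'a \<Rightarrow> 'b"
    using that
  proof (induction k arbitrary: f g)
    case 0
    then show ?case using continuous_on_cong by fastforce
  next
    case (Suc k)
    \<comment> \<open>Openness of \<open>S\<close> enters here: a derivative at \<open>x\<close>
      depends on the values in a whole neighbourhood.\<close>
    have d: "(g has_derivative frechet_derivative f (at x)) (at x)" if "x \<in> S" for x
    proof -
      have "(f has_derivative frechet_derivative f (at x)) (at x)"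
        using Suc.prems that frechet_derivative_works by auto
      then show ?thesis
        using assms(1) that Suc.prems(2) by (rule has_derivative_transform_within_open)
    qed
    have e: "frechet_derivative g (at x) = frechet_derivative f (at x)" if "x \<in> S" for x
      using d[OF that] frechet_derivative_at by metis
    have "Ck_on k S (\<lambda>x. frechet_derivative g (at x) v)" for v
    proof (rule Suc.IH)
      show "Ck_on k S (\<lambda>x. frechet_derivative f (at x) v)"
        using Suc.prems(1) by simp
      show "frechet_derivative f (at x) v = frechet_derivative g (at x) v" if "x \<in> S" for x
        using e[OF that] by simp
    qed
    moreover have "\<forall>x\<in>S. g differentiable (at x)"
      using d unfolding differentiable_def by blast
    ultimately show ?case by simp
  qed
  show ?thesis
    using *[of k f g] *[of k g f] assms(2) by auto
qed

text \<open>An explicit candidate \<open>f'\<close> stands in for \<open>frechet_derivative\<close>,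
  so that the closure properties below can be proved by induction from the usual differentiation
  rules.\<close>

lemma Ck_on_SucI:
  assumes "open S" "\<And>x. x \<in> S \<Longrightarrow> (f has_derivative f' x) (at x)"
    and "\<And>v. Ck_on k S (\<lambda>x. f' x v)"
  shows "Ck_on (Suc k) S f"
proof -
  have e: "frechet_derivative f (at x) = f' x" if "x \<in> S" for x
    using assms(2)[OF that] frechet_derivative_at by metis
  have "Ck_on k S (\<lambda>x. frechet_derivative f (at x) v)" for v
    using assms(3)[of v] by (subst Ck_on_cong[OF assms(1), where g = "\<lambda>x. f' x v"]) (auto simp: e)
  then show ?thesis
    using assms(2) by (auto simp: differentiable_def)
qed

lemma Ck_on_has_derivative:
  assumes "Ck_on (Suc k) S f" "x \<in> S"
  shows "(f has_derivative frechet_derivative f (at x)) (at x)"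
  using assms frechet_derivative_works by auto

lemma Ck_on_subset: "Ck_on k S f \<Longrightarrow> T \<subseteq> S \<Longrightarrow> Ck_on k T f"
  by (induction k arbitrary: f) (auto intro: continuous_on_subset)

lemma Ck_on_continuous: "Ck_on k S f \<Longrightarrow> continuous_on S f"
  by (cases k)
    (auto intro!: continuous_at_imp_continuous_on differentiable_imp_continuous_within)

lemma Ck_on_Suc_imp: "Ck_on (Suc k) S f \<Longrightarrow> Ck_on k S f"
proof (induction k arbitrary: f)
  case 0
  then show ?case by (metis Ck_on.simps(1) Ck_on_continuous)
qed simp

lemma Ck_on_local:
  assumes "\<And>x. x \<in> S \<Longrightarrow> \<exists>T. open T \<and> x \<in> T \<and> Ck_on k T f"
  shows "Ck_on k S f"
  using assms
proof (induction k arbitrary: f)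
  case 0
  have "isCont f x" if "x \<in> S" for x
    using 0[OF that] by (auto simp: continuous_on_eq_continuous_at)
  then show ?case by (auto intro: continuous_at_imp_continuous_on)
next
  case (Suc k)
  have "Ck_on k S (\<lambda>x. frechet_derivative f (at x) v)" for v
    using Suc.prems by (intro Suc.IH) fastforce
  moreover have "f differentiable (at x)" if "x \<in> S" for x
    using Suc.prems[OF that] by auto
  ultimately show ?case by simp
qed

lemma Ck_on_const: "open S \<Longrightarrow> Ck_on k S (\<lambda>x. c)"
proof (induction k arbitrary: c)
  case (Suc k)
  show ?case
    by (rule Ck_on_SucI[where f' = "\<lambda>_ _. 0"]) (use Suc in \<open>auto intro: Suc.IH\<close>)
qed simp

lemma Ck_on_bounded_linear_comp:
  assumes "open S" "bounded_linear L"
  shows "Ck_on k S f \<Longrightarrow> Ck_on k S (\<lambda>x. L (f x))"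
proof (induction k arbitrary: f)
  case 0
  then show ?case
    using bounded_linear.continuous_on[OF assms(2)] by auto
next
  case (Suc k)
  show ?case
  proof (rule Ck_on_SucI[OF assms(1), where f' = "\<lambda>x v. L (frechet_derivative f (at x) v)"])
    show "((\<lambda>x. L (f x)) has_derivative (\<lambda>v. L (frechet_derivative f (at x) v))) (at x)"
      if "x \<in> S" for x
      using bounded_linear.has_derivative[OF assms(2) Ck_on_has_derivative[OF Suc.prems that]] .
    show "Ck_on k S (\<lambda>x. L (frechet_derivative f (at x) v))" for v
      by (rule Suc.IH) (use Suc.prems in simp)
  qed
qed

lemma Ck_on_id: "open S \<Longrightarrow> Ck_on k S (\<lambda>x. x)"
proof (cases k)
  case (Suc j)
  assume "open S"
  then show ?thesis unfolding Suc
    by (intro Ck_on_SucI[where f' = "\<lambda>_ v. v"]) (auto intro: Ck_on_const)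
qed simp

lemma Ck_on_bounded_linear: "open S \<Longrightarrow> bounded_linear L \<Longrightarrow> Ck_on k S L"
  using Ck_on_bounded_linear_comp[OF _ _ Ck_on_id] by blast

lemma Ck_on_add:
  assumes "open S"
  shows "Ck_on k S f \<Longrightarrow> Ck_on k S g \<Longrightarrow> Ck_on k S (\<lambda>x. f x + g x)"
proof (induction k arbitrary: f g)
  case (Suc k)
  show ?case
    by (rule Ck_on_SucI[OF assms, where
          f' = "\<lambda>x v. frechet_derivative f (at x) v + frechet_derivative g (at x) v"])
      (use Suc in \<open>auto intro!: has_derivative_add Ck_on_has_derivative\<close>)
qed (auto intro: continuous_intros)

lemma Ck_on_sum:
  assumes "open S" "\<And>i. i \<in> I \<Longrightarrow> Ck_on k S (f i)"
  shows "Ck_on k S (\<lambda>x. \<Sum>i\<in>I. f i x)"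
  using assms(2)
  by (induction I rule: infinite_finite_induct) (auto simp: Ck_on_const Ck_on_add assms(1))

lemma Ck_on_scaleR:
  fixes f :: "_ \<Rightarrow> real"
  assumes "open S"
  shows "Ck_on k S f \<Longrightarrow> Ck_on k S g \<Longrightarrow> Ck_on k S (\<lambda>x. f x *\<^sub>R g x)"
proof (induction k arbitrary: f g)
  case (Suc k)
  show ?case
  proof (rule Ck_on_SucI[OF assms, where
        f' = "\<lambda>x v. f x *\<^sub>R frechet_derivative g (at x) v + frechet_derivative f (at x) v *\<^sub>R g x"])
    show "((\<lambda>x. f x *\<^sub>R g x) has_derivative
       (\<lambda>v. f x *\<^sub>R frechet_derivative g (at x) v + frechet_derivative f (at x) v *\<^sub>R g x)) (at x)"
      if "x \<in> S" for x
      using Suc.prems that by (intro has_derivative_scaleR Ck_on_has_derivative)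
    show "Ck_on k S (\<lambda>x. f x *\<^sub>R frechet_derivative g (at x) v
            + frechet_derivative f (at x) v *\<^sub>R g x)" for v
      by (intro Ck_on_add[OF assms] Suc.IH Ck_on_Suc_imp[OF Suc.prems(1)]
          Ck_on_Suc_imp[OF Suc.prems(2)]) (use Suc.prems in auto)
  qed
qed (auto intro: continuous_intros)

text \<open>\<open>Ck_on\<close> controls derivatives only in fixed directions. A direction that
  varies with the point is reduced to the fixed basis directions by this expansion.\<close>

lemma has_derivative_euclidean_expand:
  assumes "(f has_derivative f') (at x)"
  shows "f' v = (\<Sum>i\<in>Basis. (v \<bullet> i) *\<^sub>R f' i)"
proof -
  have "linear f'" using assms has_derivative_linear by blast
  then show ?thesis
    by (metis (no_types, lifting) euclidean_representation linear_scale linear_sum sum.cong)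
qed

text \<open>The chain rule differentiates \<open>f\<close> in the direction
  \<open>frechet_derivative h (at x) v\<close>, which moves with \<open>x\<close>. After expansion
  over \<open>Basis\<close>, the induction hypothesis applies to each partial derivative of
  \<open>f\<close> composed with \<open>h\<close>.\<close>

lemma Ck_on_compose:
  fixes h :: "'d::euclidean_space \<Rightarrow> 'e::euclidean_space"
  assumes "open S" "open T" "h ` S \<subseteq> T"
  shows "Ck_on k S h \<Longrightarrow> Ck_on k T f \<Longrightarrow> Ck_on k S (\<lambda>x. f (h x))"
proof (induction k arbitrary: f)
  case 0
  then show ?case
    using assms(3) by (auto intro: continuous_on_compose2)
next
  case (Suc k)
  let ?F = "\<lambda>x v. frechet_derivative f (at (h x)) (frechet_derivative h (at x) v)"
  have e: "?F x v = (\<Sum>i\<in>Basis. (frechet_derivative h (at x) v \<bullet> i) *\<^sub>R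
      frechet_derivative f (at (h x)) i)" if "x \<in> S" for x v
    using has_derivative_euclidean_expand[OF Ck_on_has_derivative[OF Suc.prems(2)]] that assms(3)
    by blast
  show ?case
  proof (rule Ck_on_SucI[OF assms(1), where f' = ?F])
    show "((\<lambda>x. f (h x)) has_derivative ?F x) (at x)" if "x \<in> S" for x
    proof -
      have "h x \<in> T" using that assms(3) by auto
      then show ?thesis
        using diff_chain_at[OF Ck_on_has_derivative[OF Suc.prems(1) that]
            Ck_on_has_derivative[OF Suc.prems(2)]] by (simp add: o_def)
    qed
    fix v
    have "Ck_on k S (\<lambda>x. \<Sum>i\<in>Basis. (frechet_derivative h (at x) v \<bullet> i) *\<^sub>R
      frechet_derivative f (at (h x)) i)"
    proof (intro Ck_on_sum[OF assms(1)] Ck_on_scaleR[OF assms(1)])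
      fix i :: 'e
      show "Ck_on k S (\<lambda>x. frechet_derivative h (at x) v \<bullet> i)"
        by (rule Ck_on_bounded_linear_comp[OF assms(1) bounded_linear_inner_left])
          (use Suc.prems in simp)
      show "Ck_on k S (\<lambda>x. frechet_derivative f (at (h x)) i)"
        by (rule Suc.IH[OF Ck_on_Suc_imp[OF Suc.prems(1)]]) (use Suc.prems in simp)
    qed
    then show "Ck_on k S (\<lambda>x. ?F x v)"
      by (subst Ck_on_cong[OF assms(1)]) (use e in auto)
  qed
qed

lemma Ck_on_inverse:
  fixes f :: "'e::euclidean_space \<Rightarrow> real"
  assumes "open S" "\<And>x. x \<in> S \<Longrightarrow> f x \<noteq> 0"
  shows "Ck_on k S f \<Longrightarrow> Ck_on k S (\<lambda>x. inverse (f x))"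
proof (induction k)
  case 0
  then show ?case using assms by (auto intro: continuous_intros)
next
  case (Suc k)
  show ?case
  proof (rule Ck_on_SucI[OF assms(1)])
    show "((\<lambda>x. inverse (f x)) has_derivative
       (\<lambda>v. - (inverse (f x) *\<^sub>R (frechet_derivative f (at x) v *\<^sub>R inverse (f x))))) (at x)"
      if "x \<in> S" for x
      using Deriv.has_derivative_inverse[OF assms(2)[OF that] Ck_on_has_derivative[OF Suc.prems that]]
      by (simp add: mult.assoc)
    show "Ck_on k S (\<lambda>x. - (inverse (f x) *\<^sub>R (frechet_derivative f (at x) v *\<^sub>R inverse (f x))))" for v
      by (intro Ck_on_bounded_linear_comp[OF assms(1) bounded_linear_minus[OF bounded_linear_ident]]
         Ck_on_scaleR[OF assms(1)] Suc.IH Ck_on_Suc_imp[OF Suc.prems]) (use Suc.prems in simp)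
  qed
qed

section \<open>Flat functions, bump functions and cutoffs\<close>

text \<open>For \<open>n = 0\<close> this is the classical smooth function that is flat at 0. The
  powers of \<open>inverse t\<close> are added because the derivatives of the family are linear
  combinations of its members, which makes smoothness a plain induction.\<close>

definition flat_exp :: "nat \<Rightarrow> real \<Rightarrow> real"
  where "flat_exp n t = (if t > 0 then inverse t ^ n * exp (- inverse t) else 0)"

lemma flat_exp_tendsto_0: "(flat_exp n \<longlongrightarrow> 0) (at 0)"
proof -
  have "((\<lambda>t. t ^ n / exp t) \<longlongrightarrow> (0::real)) at_top"
    by (rule tendsto_power_div_exp_0)
  then have "((\<lambda>t. inverse t ^ n / exp (inverse t)) \<longlongrightarrow> (0::real)) (at_right 0)"
    by (rule filterlim_compose[OF _ filterlim_inverse_at_top_right])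
  then have r: "(flat_exp n \<longlongrightarrow> 0) (at_right 0)"
    by (rule tendsto_cong[THEN iffD1, rotated])
      (auto simp: eventually_at_right_less flat_exp_def exp_minus field_simps eventually_at
        intro!: exI[of _ 1])
  have "(flat_exp n \<longlongrightarrow> 0) (at_left 0)"
    by (rule tendsto_cong[THEN iffD1, OF _ tendsto_const])
      (auto simp: flat_exp_def eventually_at intro!: exI[of _ 1])
  with r show ?thesis
    by (simp add: filterlim_split_at)
qed

lemma flat_exp_has_derivative:
  "(flat_exp n has_derivative (\<lambda>v. (flat_exp (n + 2) t - n * flat_exp (n + 1) t) * v)) (at t)"
proof -
  have "(flat_exp n has_field_derivative (flat_exp (n + 2) t - n * flat_exp (n + 1) t)) (at t)"
  proof (cases t "0::real" rule: linorder_cases)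
    case greater
    have i: "(inverse has_field_derivative - (inverse t * inverse t)) (at t)"
      using DERIV_inverse[of t UNIV] greater by (simp add: power2_eq_square)
    have p: "((\<lambda>t. inverse t ^ n) has_field_derivative - (n * inverse t ^ (n + 1))) (at t)"
    proof (cases n)
      case (Suc m)
      show ?thesis
        using DERIV_power_Suc[OF i, of m] by (simp add: Suc algebra_simps)
    qed simp
    have e: "((\<lambda>t. exp (- inverse t)) has_field_derivative
        exp (- inverse t) * (inverse t * inverse t)) (at t)"
      using DERIV_fun_exp[OF DERIV_minus[OF i]] by simp
    have "((\<lambda>t. inverse t ^ n * exp (- inverse t)) has_field_derivative
      (flat_exp (n + 2) t - n * flat_exp (n + 1) t)) (at t)"
      by (rule DERIV_cong[OF DERIV_mult[OF p e]])
        (use greater in \<open>simp add: flat_exp_def algebra_simps\<close>)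
    then show ?thesis
      using open_greaterThan[of 0] by (rule has_field_derivative_transform_within_open)
       (use greater in \<open>auto simp: flat_exp_def\<close>)
  next
    case less
    have "((\<lambda>t. 0) has_field_derivative (flat_exp (n + 2) t - n * flat_exp (n + 1) t)) (at t)"
      using less by (auto simp: flat_exp_def)
    then show ?thesis
      using open_lessThan[of 0] by (rule has_field_derivative_transform_within_open)
       (use less in \<open>auto simp: flat_exp_def\<close>)
  next
    case equal
    \<comment> \<open>Away from 0 this difference quotient is \<open>flat_exp (n + 1) y\<close>,
      whose limit at 0 is known.\<close>
    have "((\<lambda>y. (flat_exp n y - flat_exp n 0) / (y - 0)) \<longlongrightarrow> 0) (at 0)"
      using flat_exp_tendsto_0[of "n + 1"]
      by (rule tendsto_cong[THEN iffD1, rotated])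
       (auto simp: flat_exp_def eventually_at field_simps intro!: exI[of _ 1])
    then show ?thesis
      by (simp add: equal has_field_derivative_iff flat_exp_def[of _ 0])
  qed
  then show ?thesis
    by (simp add: has_field_derivative_def)
qed

lemma Ck_on_flat_exp: "Ck_on k UNIV (flat_exp n)"
proof (induction k arbitrary: n)
  case 0
  have "isCont (flat_exp n) t" for t
    using has_derivative_continuous[OF flat_exp_has_derivative] .
  then show ?case
    by (simp add: continuous_at_imp_continuous_on)
next
  case (Suc k)
  have "Ck_on k UNIV (\<lambda>t. v *\<^sub>R (flat_exp (n + 2) t + (- real n) *\<^sub>R flat_exp (n + 1) t))" for v
    by (intro Ck_on_scaleR Ck_on_add Suc Ck_on_const) auto
  then have "Ck_on k UNIV (\<lambda>t. (flat_exp (n + 2) t - n * flat_exp (n + 1) t) * v)" for v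
    by (simp add: mult.commute)
  then show ?case
    by (intro Ck_on_SucI[OF _ flat_exp_has_derivative]) auto
qed

text \<open>The standard quotient: \<open>a\<close> is positive inside the ball of radius
  \<open>r\<close>, \<open>b\<close> outside the closed ball of radius \<open>r / 2\<close>. Their
  sum is a positive constant, so one of them is always positive and the denominator \<open>d\<close>
  never vanishes. The compact set \<open>K\<close> is returned as well, since continuation by zero
  needs a compact set outside which the bump is 0.\<close>

lemma smooth_bump:
  fixes x0 :: "'e::euclidean_space"
  assumes "open U" "x0 \<in> U"
  obtains \<beta> :: "'e \<Rightarrow> real" and V K where "smooth_on UNIV \<beta>" "open V" "x0 \<in> V" "V \<subseteq> K" "compact K"
    "K \<subseteq> U" "\<And>x. x \<in> V \<Longrightarrow> \<beta> x = 1" "\<And>x. x \<notin> K \<Longrightarrow> \<beta> x = 0"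
proof -
  obtain r where r: "r > 0" "cball x0 r \<subseteq> U"
    using assms open_contains_cball by blast
  define a where "a x = r\<^sup>2 - (x - x0) \<bullet> (x - x0)" for x
  define b where "b x = (x - x0) \<bullet> (x - x0) - (r / 2)\<^sup>2" for x
  define d where "d x = flat_exp 0 (a x) + flat_exp 0 (b x)" for x
  define \<beta> where "\<beta> x = flat_exp 0 (a x) *\<^sub>R inverse (d x)" for x
  have nn: "flat_exp 0 t \<ge> 0" "t > 0 \<Longrightarrow> flat_exp 0 t > 0" for t
    by (auto simp: flat_exp_def)
  have ab: "a x > 0 \<or> b x > 0" for x
  proof -
    have "a x + b x = r\<^sup>2 - (r / 2)\<^sup>2" by (simp add: a_def b_def)
    also have "\<dots> > 0" using r by (simp add: power2_eq_square)
    finally show ?thesis by linarith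
  qed
  have d: "d x \<noteq> 0" for x
  proof (cases "a x > 0")
    case True
    then show ?thesis
      using nn(2)[OF True] nn(1)[of "b x"] unfolding d_def by linarith
  next
    case False
    then have "b x > 0" using ab[of x] by blast
    then show ?thesis
      using nn(2)[of "b x"] nn(1)[of "a x"] unfolding d_def by linarith
  qed
  have q: "Ck_on k UNIV (\<lambda>x. (x - x0) \<bullet> (x - x0))" for k
  proof -
    have "Ck_on k UNIV (\<lambda>x. \<Sum>i\<in>Basis. ((x + - x0) \<bullet> i) *\<^sub>R ((x + - x0) \<bullet> i))"
      by (intro Ck_on_sum Ck_on_scaleR Ck_on_add Ck_on_id Ck_on_const
          Ck_on_bounded_linear_comp[OF _ bounded_linear_inner_left]) auto
    moreover have "(x + - x0) \<bullet> (x + - x0) = (\<Sum>i\<in>Basis. ((x + - x0) \<bullet> i) *\<^sub>R ((x + - x0) \<bullet> i))" for x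
      unfolding real_scaleR_def by (rule euclidean_inner)
    ultimately show ?thesis
      by (metis (no_types, lifting) ext diff_conv_add_uminus)
  qed
  have a: "Ck_on k UNIV a" for k
  proof -
    have "Ck_on k UNIV (\<lambda>x. r\<^sup>2 + (-1) *\<^sub>R ((x - x0) \<bullet> (x - x0)))"
      by (intro Ck_on_scaleR Ck_on_add Ck_on_const q) auto
    then show ?thesis by (simp add: a_def[abs_def])
  qed
  have b: "Ck_on k UNIV b" for k
  proof -
    have "Ck_on k UNIV (\<lambda>x. ((x - x0) \<bullet> (x - x0)) + (- (r/2)\<^sup>2))"
      by (intro Ck_on_scaleR Ck_on_add Ck_on_const q) auto
    then show ?thesis by (simp add: b_def[abs_def])
  qed
  show thesis
  proof (rule that[of \<beta> "ball x0 (r / 2)" "cball x0 r"])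
    show "smooth_on UNIV \<beta>"
      unfolding smooth_on_def \<beta>_def
      by (intro allI Ck_on_scaleR Ck_on_inverse)
        (use d in \<open>auto simp: d_def[abs_def] intro!: Ck_on_add Ck_on_compose[OF _ _ _ a Ck_on_flat_exp]
          Ck_on_compose[OF _ _ _ b Ck_on_flat_exp]\<close>)
    show "\<beta> x = 1" if "x \<in> ball x0 (r / 2)" for x
    proof -
      have "norm (x - x0) < r / 2" using that by (simp add: dist_norm norm_minus_commute)
      then have "(norm (x - x0))\<^sup>2 < (r / 2)\<^sup>2"
        by (intro power_strict_mono) auto
      then have "b x \<le> 0" by (simp add: b_def power2_norm_eq_inner)
      then have "d x = flat_exp 0 (a x)" by (simp add: d_def flat_exp_def)
      then show ?thesis using d[of x] by (simp add: \<beta>_def)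
    qed
    show "\<beta> x = 0" if "x \<notin> cball x0 r" for x
    proof -
      have "norm (x - x0) > r" using that by (simp add: dist_norm norm_minus_commute)
      then have "(norm (x - x0))\<^sup>2 > r\<^sup>2"
        using r by (intro power_strict_mono) auto
      then have "a x \<le> 0" by (simp add: a_def power2_norm_eq_inner)
      then show ?thesis by (simp add: \<beta>_def flat_exp_def)
    qed
  qed (use r in auto)
qed

text \<open>Nothing is known about \<open>f\<close> outside \<open>W\<close>. The open sets
  \<open>W\<close> and the complement of \<open>K\<close> cover the space, and on the latter the
  product is identically 0.\<close>

lemma Ck_on_cutoff:
  fixes f :: "'e::euclidean_space \<Rightarrow> 'f::real_normed_vector"
  assumes "Ck_on k W f" "open W" "Ck_on k UNIV \<beta>" "compact K" "K \<subseteq> W" "\<And>x. x \<notin> K \<Longrightarrow> \<beta> x = 0"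
  shows "Ck_on k UNIV (\<lambda>x. \<beta> x *\<^sub>R f x)"
proof (rule Ck_on_local)
  fix x :: 'e
  show "\<exists>T. open T \<and> x \<in> T \<and> Ck_on k T (\<lambda>x. \<beta> x *\<^sub>R f x)"
  proof (cases "x \<in> W")
    case True
    have "Ck_on k W (\<lambda>x. \<beta> x *\<^sub>R f x)"
      by (rule Ck_on_scaleR[OF assms(2) Ck_on_subset[OF assms(3) subset_UNIV] assms(1)])
    with True show ?thesis using assms(2) by blast
  next
    case False
    have o: "open (- K)" using assms(4) by (simp add: compact_imp_closed open_Compl)
    have "\<beta> x *\<^sub>R f x = 0" if "x \<in> - K" for x
      using assms(6)[of x] that by simp
    then have "Ck_on k (- K) (\<lambda>x. \<beta> x *\<^sub>R f x)"
      using Ck_on_cong[OF o, of "\<lambda>x. \<beta> x *\<^sub>R f x" "\<lambda>x. 0"] Ck_on_const[OF o] by blast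
    moreover have "x \<in> - K" using False assms(5) by blast
    ultimately show ?thesis
      using o by blast
  qed
qed

section \<open>Smooth left inverses of immersions and the Hadamard lemma\<close>

lemma smooth_onD: "smooth_on S f \<Longrightarrow> Ck_on k S f"
  by (simp add: smooth_on_def)

lemma Ck_on_transform:
  assumes "Ck_on k S f" "open S" "\<And>x. x \<in> S \<Longrightarrow> f x = g x"
  shows "Ck_on k S g"
  using Ck_on_cong[OF assms(2,3)] assms(1) by simp

lemma smooth_on_transform:
  assumes "smooth_on S f" "open S" "\<And>x. x \<in> S \<Longrightarrow> f x = g x"
  shows "smooth_on S g"
  using Ck_on_transform[OF _ assms(2,3)] assms(1) by (simp add: smooth_on_def)

lemma smooth_on_subset: "smooth_on S f \<Longrightarrow> T \<subseteq> S \<Longrightarrow> smooth_on T f"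
  unfolding smooth_on_def using Ck_on_subset by blast

lemma smooth_on_frechet_derivative:
  assumes "smooth_on S f"
  shows "smooth_on S (\<lambda>x. frechet_derivative f (at x) v)"
  unfolding smooth_on_def
proof
  fix k
  show "Ck_on k S (\<lambda>x. frechet_derivative f (at x) v)"
    using smooth_onD[OF assms, of "Suc k"] by simp
qed

lemma smooth_on_has_derivative:
  "smooth_on S f \<Longrightarrow> x \<in> S \<Longrightarrow> (f has_derivative frechet_derivative f (at x)) (at x)"
  using Ck_on_has_derivative smooth_onD by blast

section \<open>Differentiation under the integral sign and the Hadamard lemma\<close>

text \<open>Directionwise continuity of a derivative becomes continuity in operator norm, the form
  required by the Leibniz rule and the inverse function theorem. In finite dimension the operator is
  assembled from its matrix entries.\<close>

lemma continuous_on_Blinfun: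
  fixes f' :: "'a::topological_space \<Rightarrow> 'd::euclidean_space \<Rightarrow> 'e::euclidean_space"
  assumes "\<And>x. x \<in> S \<Longrightarrow> bounded_linear (f' x)" "\<And>v. continuous_on S (\<lambda>x. f' x v)"
  shows "continuous_on S (\<lambda>x. Blinfun (f' x))"
proof -
  have "continuous_on S (\<lambda>x. blinfun_of_matrix (\<lambda>i j. f' x j \<bullet> i))"
    by (intro continuous_intros assms(2))
  moreover have "blinfun_of_matrix (\<lambda>i j. f' x j \<bullet> i) = Blinfun (f' x)" if "x \<in> S" for x
    using blinfun_of_matrix_works[of "Blinfun (f' x)"]
    by (simp add: bounded_linear_Blinfun_apply assms(1) that)
  ultimately show ?thesis by simp
qed

lemma segment_in_convex:
  assumes "convex S" "x \<in> S" "y \<in> S" "t \<in> {0..1::real}"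
  shows "x + t *\<^sub>R (y - x) \<in> S"
  using convexD_alt[OF assms(1-3), of t] assms(4) by (simp add: algebra_simps)

text \<open>The weight \<open>w\<close> makes the induction close: differentiating the integrand in
  \<open>x\<close> brings out a factor \<open>t\<close> from the inner map, so the derivative is an
  integral of the same shape with weight \<open>w t * t\<close>.\<close>

lemma Ck_on_segment_integral:
  fixes f :: "'e::euclidean_space \<Rightarrow> real"
  assumes "open S" "convex S" "x0 \<in> S"
    and "Ck_on k S f" "continuous_on {0..1} w"
  shows "Ck_on k S (\<lambda>x. integral {0..1} (\<lambda>t. w t * f (x0 + t *\<^sub>R (x - x0))))"
proof -
  have seg: "x0 + t *\<^sub>R (x - x0) \<in> S" if "x \<in> S" "0 \<le> t" "t \<le> 1" for x t
    using segment_in_convex[OF assms(2,3)] that by auto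
  have sub1: "(\<lambda>p. x0 + snd p *\<^sub>R (fst p - x0)) ` (S \<times> cbox 0 1) \<subseteq> S"
    and sub2: "\<And>x. x \<in> S \<Longrightarrow> (\<lambda>t. x0 + t *\<^sub>R (x - x0)) ` {0..1} \<subseteq> S"
    by (auto intro!: seg)
  have c1: "continuous_on (S \<times> cbox 0 1) (\<lambda>p. w (snd p) * f (x0 + snd p *\<^sub>R (fst p - x0)))"
    if "continuous_on {0..1} w" "continuous_on S f" for w and f :: "_ \<Rightarrow> real"
    by (intro continuous_intros continuous_on_compose2[OF that(1)]
        continuous_on_compose2[OF that(2) _ sub1]) auto
  have c2: "continuous_on {0..1} (\<lambda>t. w t * f (x0 + t *\<^sub>R (x - x0)))"
    if "continuous_on {0..1} w" "continuous_on S f" "x \<in> S" for w and f :: "_ \<Rightarrow> real" and x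
    by (intro continuous_intros that(1) continuous_on_compose2[OF that(2) _ sub2[OF that(3)]])
  show ?thesis
    using assms(4,5)
  proof (induction k arbitrary: f w)
    case 0
    have "continuous_on (S \<times> cbox 0 1) (\<lambda>(x, t). w t * f (x0 + t *\<^sub>R (x - x0)))"
      unfolding split_beta
      by (rule c1) (use 0 in auto)
    then show ?case
      using integral_continuous_on_param[of S 0 1 "\<lambda>x t. w t * f (x0 + t *\<^sub>R (x - x0))"]
      by simp
  next
    case (Suc k)
    define d where "d x = Blinfun (frechet_derivative f (at x))" for x
    have bl: "bounded_linear (frechet_derivative f (at x))" if "x \<in> S" for x
      using Ck_on_has_derivative[OF Suc.prems(1) that] has_derivative_bounded_linear by blast
    have d: "blinfun_apply (d x) = frechet_derivative f (at x)" if "x \<in> S" for x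
      unfolding d_def using bl[OF that] by (rule bounded_linear_Blinfun_apply)
    have cd: "continuous_on S d"
      unfolding d_def
      by (rule continuous_on_Blinfun[OF bl Ck_on_continuous[where k = k]]) (use Suc.prems in auto)
    define D where "D x t = (w t * t) *\<^sub>R d (x0 + t *\<^sub>R (x - x0))" for x t
    have cD: "continuous_on (S \<times> cbox 0 1) (\<lambda>(x, t). D x t)"
      unfolding split_beta D_def
      by (intro continuous_intros continuous_on_compose2[OF Suc.prems(2)]
          continuous_on_compose2[OF cd _ sub1]) auto
    have cf: "continuous_on {0..1} (\<lambda>t. w t * f (x0 + t *\<^sub>R (x - x0)))" if "x \<in> S" for x
      by (rule c2[OF Suc.prems(2) Ck_on_continuous[OF Suc.prems(1)] that])
    have cDx: "continuous_on {0..1} (D x)" if "x \<in> S" for x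
      unfolding D_def
      by (intro continuous_intros Suc.prems(2) continuous_on_compose2[OF cd _ sub2[OF that]])
    have der: "((\<lambda>x. w t * f (x0 + t *\<^sub>R (x - x0))) has_derivative blinfun_apply (D x t)) (at x)"
      if "x \<in> S" "t \<in> {0..1}" for x t
    proof -
      have S: "x0 + t *\<^sub>R (x - x0) \<in> S"
        using segment_in_convex[OF assms(2,3)] that by blast
      have g: "((\<lambda>x. x0 + t *\<^sub>R (x - x0)) has_derivative (\<lambda>v. t *\<^sub>R v)) (at x)"
        by (auto intro!: derivative_eq_intros)
      note * = diff_chain_at[OF g Ck_on_has_derivative[OF Suc.prems(1) S]]
      have "((\<lambda>x. w t * f (x0 + t *\<^sub>R (x - x0))) has_derivative
         (\<lambda>v. w t * frechet_derivative f (at (x0 + t *\<^sub>R (x - x0))) (t *\<^sub>R v))) (at x)"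
        using has_derivative_mult_right[OF *, of "w t"] by (simp add: o_def)
      moreover have "(\<lambda>v. w t * frechet_derivative f (at (x0 + t *\<^sub>R (x - x0))) (t *\<^sub>R v))
          = blinfun_apply (D x t)"
        using linear_scale[OF bounded_linear.linear[OF bl[OF S]]]
        by (simp add: D_def d[OF S] scaleR_blinfun.rep_eq fun_eq_iff)
      ultimately show ?thesis by simp
    qed
    let ?f' = "\<lambda>x v. integral {0..1} (\<lambda>t. (w t * t) * frechet_derivative f (at (x0 + t *\<^sub>R (x - x0))) v)"
    show ?case
    proof (rule Ck_on_SucI[OF assms(1), where f' = ?f'])
      fix x assume x: "x \<in> S"
      have "((\<lambda>x. integral (cbox 0 1) (\<lambda>t. w t * f (x0 + t *\<^sub>R (x - x0)))) has_derivative
        blinfun_apply (integral (cbox 0 1) (D x))) (at x within S)"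
      proof (rule leibniz_rule[where U = S])
        show "((\<lambda>x. w t * f (x0 + t *\<^sub>R (x - x0))) has_derivative blinfun_apply (D y t)) (at y within S)"
          if "y \<in> S" "t \<in> cbox 0 1" for y t
          using der that by (simp add: has_derivative_at_withinI)
        show "(\<lambda>t. w t * f (x0 + t *\<^sub>R (y - x0))) integrable_on cbox 0 1" if "y \<in> S" for y
          using integrable_continuous_real[OF cf[OF that]] by simp
      qed (use cD x assms(2) in auto)
      moreover have "blinfun_apply (integral (cbox 0 1) (D x)) = ?f' x"
      proof
        fix v
        have "blinfun_apply (integral (cbox 0 1) (D x)) v
            = integral {0..1} (\<lambda>t. blinfun_apply (D x t) v)"
          using blinfun_apply_integral[OF integrable_continuous_real[OF cDx[OF x]]] by simp
        also have "\<dots> = ?f' x v"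
        proof (rule integral_cong)
          fix t :: real assume "t \<in> {0..1}"
          then have "x0 + t *\<^sub>R (x - x0) \<in> S"
            using seg[OF x] by simp
          then show "blinfun_apply (D x t) v
              = w t * t * frechet_derivative f (at (x0 + t *\<^sub>R (x - x0))) v"
            by (simp add: D_def scaleR_blinfun.rep_eq d)
        qed
        finally show "blinfun_apply (integral (cbox 0 1) (D x)) v = ?f' x v" .
      qed
      ultimately show "((\<lambda>x. integral {0..1} (\<lambda>t. w t * f (x0 + t *\<^sub>R (x - x0)))) has_derivative ?f' x) (at x)"
        by (simp only: at_within_open[OF x assms(1)] box_real)
    next
      fix v
      show "Ck_on k S (\<lambda>x. ?f' x v)"
      proof (rule Suc.IH)
        show "Ck_on k S (\<lambda>x. frechet_derivative f (at x) v)"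
          using Suc.prems(1) by simp
        show "continuous_on {0..1} (\<lambda>t. w t * t)"
          by (intro continuous_intros Suc.prems(2))
      qed
    qed
  qed
qed

text \<open>Integrate the derivative of \<open>f\<close> along the segment from \<open>x0\<close> to
  \<open>x\<close>: the coefficient \<open>h i x\<close> is the mean of the partial derivative in
  direction \<open>i\<close> over that segment.\<close>

lemma hadamard:
  fixes f :: "'e::euclidean_space \<Rightarrow> real"
  assumes "open S" "convex S" "x0 \<in> S" "smooth_on S f"
  obtains h where "\<And>i. smooth_on S (h i)" "\<And>i. h i x0 = frechet_derivative f (at x0) i"
    "\<And>x. x \<in> S \<Longrightarrow> f x = f x0 + (\<Sum>i\<in>Basis. ((x - x0) \<bullet> i) * h i x)"
proof -
  \<comment> \<open>The factor 1 is the constant weight with which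
    \<open>Ck_on_segment_integral\<close> is applied.\<close>
  define h where "h i x = integral {0..1}
    (\<lambda>t. 1 * frechet_derivative f (at (x0 + t *\<^sub>R (x - x0))) i)" for i x
  show thesis
  proof (rule that[of h])
    show "smooth_on S (h i)" for i
      unfolding smooth_on_def h_def
      by (intro allI Ck_on_segment_integral[OF assms(1-3)] continuous_on_const
          smooth_onD smooth_on_frechet_derivative assms(4))
    show "h i x0 = frechet_derivative f (at x0) i" for i
      by (simp add: h_def)
    show "f x = f x0 + (\<Sum>i\<in>Basis. ((x - x0) \<bullet> i) * h i x)" if "x \<in> S" for x
    proof -
      let ?g = "\<lambda>t. x0 + t *\<^sub>R (x - x0)"
      have S: "?g t \<in> S" if "t \<in> {0..1}" for t
        using segment_in_convex[OF assms(2,3) \<open>x \<in> S\<close> that] .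
      have "((\<lambda>t. f (?g t)) has_vector_derivative frechet_derivative f (at (?g t)) (x - x0))
          (at t within {0..1})" if "t \<in> {0..1}" for t
      proof -
        have g: "(?g has_vector_derivative (x - x0)) (at t within {0..1})"
          by (auto intro!: derivative_eq_intros)
        show ?thesis
          using vector_derivative_diff_chain_within[OF g, of f "frechet_derivative f (at (?g t))"]
            smooth_on_has_derivative[OF assms(4) S[OF that]] has_derivative_at_withinI
          by (auto simp: o_def)
      qed
      then have "((\<lambda>t. frechet_derivative f (at (?g t)) (x - x0)) has_integral (f (?g 1) - f (?g 0))) {0..1}"
        by (intro fundamental_theorem_of_calculus) auto
      then have "f x - f x0 = integral {0..1} (\<lambda>t. frechet_derivative f (at (?g t)) (x - x0))"
        by (simp add: integral_unique)
      also have "\<dots> = integral {0..1} (\<lambda>t. \<Sum>i\<in>Basis. ((x - x0) \<bullet> i) * frechet_derivative f (at (?g t)) i)"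
        using has_derivative_euclidean_expand[OF smooth_on_has_derivative[OF assms(4) S], of _ "x - x0"]
        by (intro integral_cong) auto
      also have "\<dots> = (\<Sum>i\<in>Basis. integral {0..1} (\<lambda>t. ((x - x0) \<bullet> i) * frechet_derivative f (at (?g t)) i))"
      proof (rule integral_sum)
        fix i :: 'e
        have "continuous_on {0..1} (\<lambda>t. frechet_derivative f (at (?g t)) i)"
          by (rule continuous_on_compose2[OF Ck_on_continuous[OF smooth_onD[OF
                smooth_on_frechet_derivative[OF assms(4)], where k = 0]]])
           (use S in \<open>auto intro!: continuous_intros\<close>)
        then show "(\<lambda>t. ((x - x0) \<bullet> i) * frechet_derivative f (at (?g t)) i) integrable_on {0..1}"
          by (intro integrable_continuous_real continuous_intros)
      qed simp
      also have "\<dots> = (\<Sum>i\<in>Basis. ((x - x0) \<bullet> i) * h i x)"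
        by (simp add: h_def)
      finally show ?thesis by simp
    qed
  qed
qed

section \<open>Smoothness of inverse functions and local left inverses\<close>

text \<open>A product rule for a factor \<open>t\<close> that is merely continuous: the term with
  the derivative of \<open>t\<close> would be multiplied by \<open>s y = 0\<close>. It lets the
  derivative of an inverse function be differentiated when only its continuity is known.\<close>

lemma has_derivative_scaleR_vanishing:
  fixes s :: "'a::real_normed_vector \<Rightarrow> real" and t :: "'a \<Rightarrow> 'b::real_normed_vector"
  assumes s: "(s has_derivative s') (at y)" and "s y = 0" and t: "isCont t y"
  shows "((\<lambda>x. s x *\<^sub>R t x) has_derivative (\<lambda>u. s' u *\<^sub>R t y)) (at y)"
proof -
  have bl: "bounded_linear s'" using s has_derivative_bounded_linear by blast
  obtain C where C: "\<And>u. norm (s' u) \<le> norm u * C"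
    using bounded_linear.bounded[OF bl] by blast
  have ts: "((\<lambda>x. (s x - s y - s' (x - y)) /\<^sub>R norm (x - y)) \<longlongrightarrow> 0) (at y)"
    using s by (simp add: has_derivative_at_within)
  have tt: "(t \<longlongrightarrow> t y) (at y)" using t by (simp add: isCont_def)
  \<comment> \<open>The error splits into the remainder of \<open>s\<close> times
    \<open>t x\<close>, and the linear part \<open>s' (x - y)\<close> times
    \<open>t x - t y\<close>. In the second the quotient by \<open>norm (x - y)\<close> stays
    bounded by \<open>C\<close>.\<close>
  have 1: "((\<lambda>x. ((s x - s y - s' (x - y)) /\<^sub>R norm (x - y)) *\<^sub>R t x) \<longlongrightarrow> 0) (at y)"
    using tendsto_scaleR[OF ts tt] by simp
  have 2: "((\<lambda>x. (s' (x - y) /\<^sub>R norm (x - y)) *\<^sub>R (t x - t y)) \<longlongrightarrow> 0) (at y)"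
  proof (rule Lim_null_comparison)
    have "norm ((s' (x - y) /\<^sub>R norm (x - y)) *\<^sub>R (t x - t y)) \<le> C * norm (t x - t y)"
      if "x \<noteq> y" for x
    proof -
      have "norm (s' (x - y) /\<^sub>R norm (x - y)) \<le> C"
        using C[of "x - y"] that by (simp add: divide_simps mult.commute)
      from mult_right_mono[OF this norm_ge_zero] show ?thesis
        by (simp only: norm_scaleR[of "s' (x - y) /\<^sub>R norm (x - y)"] real_norm_def)
    qed
    then show "\<forall>\<^sub>F x in at y. norm ((s' (x - y) /\<^sub>R norm (x - y)) *\<^sub>R (t x - t y)) \<le> C * norm (t x - t y)"
      by (simp add: eventually_at_filter)
    show "((\<lambda>x. C * norm (t x - t y)) \<longlongrightarrow> 0) (at y)"
      using tendsto_mult_left[OF tendsto_norm[OF tendsto_diff[OF tt tendsto_const[of "t y"]]], of C]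
      by simp
  qed
  have "((\<lambda>x. (s x *\<^sub>R t x - s y *\<^sub>R t y - s' (x - y) *\<^sub>R t y) /\<^sub>R norm (x - y)) \<longlongrightarrow> 0) (at y)"
    using tendsto_add[OF 1 2] by (simp add: assms(2) algebra_simps)
  moreover have "bounded_linear (\<lambda>u. s' u *\<^sub>R t y)"
    using bl by (rule bounded_linear_scaleR_const)
  ultimately show ?thesis
    by (simp add: has_derivative_at_within)
qed

text \<open>Bootstrapping: with \<open>M y = DH (G y)\<close>, the derivative \<open>N y\<close> of \<open>G\<close> satisfies
  \<open>N x v = N y v + N x (z x)\<close> where \<open>z x = v - M x (N y v)\<close> vanishes at \<open>y\<close>. Hence \<open>N\<close> is
  continuous, and differentiable with a derivative expressed by \<open>N\<close>, \<open>G\<close> and the second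
  derivatives of \<open>H\<close>; so each order of smoothness of \<open>N\<close> gives the next.\<close>

lemma Ck_on_inverse_function:
  fixes H G :: "'e::euclidean_space \<Rightarrow> 'e"
  assumes V: "open V" and U: "open U" and GV: "G ` V \<subseteq> U" and H: "smooth_on U H"
    and N: "\<And>y. y \<in> V \<Longrightarrow> (G has_derivative N y) (at y)"
    and inv1: "\<And>y v. y \<in> V \<Longrightarrow> N y (frechet_derivative H (at (G y)) v) = v"
    and inv2: "\<And>y v. y \<in> V \<Longrightarrow> frechet_derivative H (at (G y)) (N y v) = v"
    and bound: "\<And>y v. y \<in> V \<Longrightarrow> norm (N y v) \<le> C * norm v"
  shows "Ck_on k V G"
proof -
  define M where "M j x = frechet_derivative H (at x) j" for j x
  have lN: "linear (N y)" if "y \<in> V" for y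
    using N[OF that] has_derivative_linear by blast
  have M: "smooth_on U (M j)" for j
    unfolding M_def by (rule smooth_on_frechet_derivative[OF H])
  have DM: "((\<lambda>y. M j (G y)) has_derivative (\<lambda>u. frechet_derivative (M j) (at (G y)) (N y u))) (at y)"
    if "y \<in> V" for j y
    using diff_chain_at[OF N[OF that] smooth_on_has_derivative[OF M]] that GV
    by (auto simp: o_def)
  have sumM: "frechet_derivative H (at (G y)) w = (\<Sum>j\<in>Basis. (w \<bullet> j) *\<^sub>R M j (G y))" if "y \<in> V" for y w
    unfolding M_def
    by (rule has_derivative_euclidean_expand[OF smooth_on_has_derivative[OF H]]) (use that GV in auto)
  have diffN: "N x v = N y v + N x (v - frechet_derivative H (at (G x)) (N y v))"
    if "x \<in> V" for x y v
    using lN[OF that] inv1[OF that] by (simp add: linear_diff)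
  define z where "z y v x = v - (\<Sum>j\<in>Basis. (N y v \<bullet> j) *\<^sub>R M j (G x))" for y v x
  have z0: "z y v y = 0" if "y \<in> V" for y v
    using inv2[OF that, of v] sumM[OF that] by (simp add: z_def)
  have Nz: "N x v = N y v + N x (z y v x)" if "x \<in> V" for x y v
    using diffN[OF that, of v y] sumM[OF that] by (simp add: z_def)
  have Dz: "(z y v has_derivative
      (\<lambda>u. - (\<Sum>j\<in>Basis. (N y v \<bullet> j) *\<^sub>R frechet_derivative (M j) (at (G y)) (N y u)))) (at y)"
    if "y \<in> V" for y v
    unfolding z_def using that
    by (auto intro!: derivative_eq_intros DM)
  have contN: "isCont (\<lambda>x. N x v) y" if y: "y \<in> V" for y v
    unfolding isCont_def
  proof (subst Lim_null, rule Lim_null_comparison)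
    \<comment> \<open>The bound \<open>C\<close> is uniform in \<open>x\<close>, so the unknown
      operator \<open>N x\<close> cannot spoil the convergence of \<open>z y v x\<close> to
      0.\<close>
    have "norm (N x v - N y v) \<le> C * norm (z y v x)" if "x \<in> V" for x
      using Nz[OF that, of v y] bound[OF that, of "z y v x"] by simp
    then show "\<forall>\<^sub>F x in at y. norm (N x v - N y v) \<le> C * norm (z y v x)"
      using eventually_at_in_open'[OF V y] by (rule eventually_mono[rotated])
    have "(z y v \<longlongrightarrow> 0) (at y)"
      using has_derivative_continuous[OF Dz[OF y, of v]] z0[OF y, of v] by (simp add: isCont_def)
    then show "((\<lambda>x. C * norm (z y v x)) \<longlongrightarrow> 0) (at y)"
      using tendsto_mult_left[OF tendsto_norm, of "z y v" 0] by simp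
  qed
  define Q where "Q j l x = frechet_derivative (M j) (at x) l" for j l x
  \<comment> \<open>This is \<open>- N y\<close> applied to the second derivative of
    \<open>H\<close> at \<open>G y\<close> in the directions \<open>N y u\<close> and
    \<open>N y v\<close>, the formula for the derivative of an inverse operator. Written over
    \<open>Basis\<close>, it consists of sums and products of terms of known smoothness.\<close>
  define R where "R v y u = (\<Sum>i\<in>Basis. ((- (\<Sum>j\<in>Basis. (N y v \<bullet> j) *\<^sub>R
      (\<Sum>l\<in>Basis. (N y u \<bullet> l) *\<^sub>R Q j l (G y)))) \<bullet> i) *\<^sub>R N y i)" for v y u
  have DN: "((\<lambda>x. N x v) has_derivative R v y) (at y)" if y: "y \<in> V" for y v
  proof -
    have e: "frechet_derivative (M j) (at (G y)) w = (\<Sum>l\<in>Basis. (w \<bullet> l) *\<^sub>R Q j l (G y))" for j w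
      unfolding Q_def
      by (rule has_derivative_euclidean_expand[OF smooth_on_has_derivative[OF M]]) (use y GV in auto)
    have s: "((\<lambda>x. (z y v x \<bullet> i) *\<^sub>R N x i) has_derivative
      (\<lambda>u. ((- (\<Sum>j\<in>Basis. (N y v \<bullet> j) *\<^sub>R frechet_derivative (M j) (at (G y)) (N y u))) \<bullet> i) *\<^sub>R N y i))
      (at y)" for i
      by (rule has_derivative_scaleR_vanishing[OF has_derivative_inner_left[OF Dz[OF y]]])
        (use z0[OF y] contN[OF y] in auto)
    have "((\<lambda>x. N y v + (\<Sum>i\<in>Basis. (z y v x \<bullet> i) *\<^sub>R N x i)) has_derivative R v y) (at y)"
      using has_derivative_add[OF has_derivative_const has_derivative_sum[OF s]]
      by (simp add: R_def[abs_def] e)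
    then show ?thesis
    proof (rule has_derivative_transform_within_open[OF _ V y])
      fix x assume x: "x \<in> V"
      have "N x (z y v x) = (\<Sum>i\<in>Basis. (z y v x \<bullet> i) *\<^sub>R N x i)"
        using has_derivative_euclidean_expand[OF N[OF x]] .
      then show "N y v + (\<Sum>i\<in>Basis. (z y v x \<bullet> i) *\<^sub>R N x i) = N x v"
        using Nz[OF x, of v y] by simp
    qed
  qed
  have CN: "Ck_on k V (\<lambda>y. N y v)" for k v
  proof (induction k arbitrary: v)
    case 0
    then show ?case using contN by (simp add: continuous_at_imp_continuous_on)
  next
    case (Suc k)
    have G: "Ck_on k V G"
      by (rule Ck_on_Suc_imp[OF Ck_on_SucI[OF V N Suc]])
    have Q: "Ck_on k V (\<lambda>y. Q j l (G y))" for j l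
      by (rule Ck_on_compose[OF V U GV G])
        (auto simp: Q_def[abs_def] intro!: smooth_onD smooth_on_frechet_derivative M)
    have "Ck_on k V (\<lambda>y. R v y u)" for u
      unfolding R_def
      by (intro Ck_on_sum Ck_on_scaleR V Suc Q
          Ck_on_bounded_linear_comp[OF V bounded_linear_inner_left]
          Ck_on_bounded_linear_comp[OF V bounded_linear_minus[OF bounded_linear_ident]])
    then show ?case
      using Ck_on_SucI[OF V DN] by blast
  qed
  show ?thesis
    by (rule Ck_on_Suc_imp[OF Ck_on_SucI[OF V N CN]])
qed

lemma smooth_immersion_left_inverse:
  fixes F :: "'h::euclidean_space \<Rightarrow> 'e::euclidean_space"
  assumes "open S" "x0 \<in> S" "smooth_on S F" "inj (frechet_derivative F (at x0))"
  obtains T R W where "open T" "smooth_on T R" "R ` T \<subseteq> S" "open W" "x0 \<in> W" "W \<subseteq> S"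
    "\<And>x. x \<in> W \<Longrightarrow> F x \<in> T" "\<And>x. x \<in> W \<Longrightarrow> R (F x) = x"
proof -
  have "linear (frechet_derivative F (at x0))"
    using smooth_on_has_derivative[OF assms(3,2)] has_derivative_linear by blast
  \<comment> \<open>Composing with a linear left inverse of the derivative reduces the claim to the inverse function
    theorem at a point where the derivative is the identity; nearby, the inverse derivatives are
    then bounded by 2.\<close>
  then obtain P where P: "linear P" "P \<circ> frechet_derivative F (at x0) = id"
    using linear_injective_left_inverse assms(4) by blast
  have blP: "bounded_linear P" using P(1) linear_conv_bounded_linear by blast
  define H where "H x = P (F x)" for x
  have H: "smooth_on S H"
    unfolding H_def smooth_on_def
    using Ck_on_bounded_linear_comp[OF assms(1) blP] smooth_onD[OF assms(3)] by blast
  define d where "d x = Blinfun (frechet_derivative H (at x))" for x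
  have bl: "bounded_linear (frechet_derivative H (at x))" if "x \<in> S" for x
    using smooth_on_has_derivative[OF H that] has_derivative_bounded_linear by blast
  have d: "blinfun_apply (d x) = frechet_derivative H (at x)" if "x \<in> S" for x
    unfolding d_def using bl[OF that] by (rule bounded_linear_Blinfun_apply)
  have cd: "continuous_on S d"
    unfolding d_def
    by (rule continuous_on_Blinfun[OF bl Ck_on_continuous[where k = 0]])
      (use smooth_onD[OF smooth_on_frechet_derivative[OF H]] in auto)
  have "frechet_derivative H (at x0) = P \<circ> frechet_derivative F (at x0)"
    unfolding H_def
    using bounded_linear.has_derivative[OF blP smooth_on_has_derivative[OF assms(3,2)]]
      frechet_derivative_at by (metis comp_def ext)
  then have d0: "d x0 = id_blinfun"
    by (intro blinfun_eqI) (simp add: d assms(2) P(2))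
  \<comment> \<open>The radius 1/2 gives \<open>norm (N y v - v) \<le> 1/2 * norm (N y v)\<close>
    below, and hence the bound 2 on the inverse derivatives.\<close>
  define U where "U = S \<inter> d -` ball id_blinfun (1/2)"
  have U: "open U" "U \<subseteq> S" "x0 \<in> U"
    using continuous_open_preimage[OF cd assms(1) open_ball] assms(2) d0
    by (auto simp: U_def)
  have dH: "(H has_derivative blinfun_apply (d x)) (at x)" if "x \<in> U" for x
    using smooth_on_has_derivative[OF H] d that U(2) by auto
  have idH: "id_blinfun o\<^sub>L d x0 = id_blinfun"
    unfolding d0 by (rule blinfun_eqI) simp
  obtain U' V G N where U': "open U'" "U' \<subseteq> U" "x0 \<in> U'" and V: "open V" "H x0 \<in> V"
    and hom: "homeomorphism U' V H G"
    and N: "\<And>y. y \<in> V \<Longrightarrow> (G has_derivative (N y)) (at y)"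
    and N': "\<And>y. y \<in> V \<Longrightarrow> N y = inv (blinfun_apply (d (G y)))"
    and bij: "\<And>y. y \<in> V \<Longrightarrow> bij (blinfun_apply (d (G y)))"
    using inverse_function_theorem[OF U(1) dH continuous_on_subset[OF cd U(2)] U(3) idH] by blast
  have GV: "G ` V = U'" using hom by (auto simp: homeomorphism_def)
  have GS: "G y \<in> S" if "y \<in> V" for y
    using that GV U' U by blast
  have inv1: "N y (frechet_derivative H (at (G y)) v) = v" if "y \<in> V" for y v
    using N'[OF that] bij[OF that] d[OF GS[OF that]] by (simp add: bij_is_inj)
  have inv2: "frechet_derivative H (at (G y)) (N y v) = v" if "y \<in> V" for y v
    using N'[OF that] bij[OF that] d[OF GS[OF that]] by (simp add: bij_is_surj surj_f_inv_f)
  have bound: "norm (N y v) \<le> 2 * norm v" if "y \<in> V" for y v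
  proof -
    have "G y \<in> U" using that GV U' by blast
    then have n: "norm (id_blinfun - d (G y)) \<le> 1/2"
      by (simp add: U_def dist_norm)
    have "norm (N y v - v) = norm (blinfun_apply (id_blinfun - d (G y)) (N y v))"
      using inv2[OF that] d[OF GS[OF that]] by (simp add: minus_blinfun.rep_eq)
    also have "\<dots> \<le> 1/2 * norm (N y v)"
      using norm_blinfun[of "id_blinfun - d (G y)" "N y v"] mult_right_mono[OF n norm_ge_zero]
      by (meson order_trans)
    finally show ?thesis
      using norm_triangle_ineq[of "N y v - v" v] by simp
  qed
  have G: "Ck_on k V G" for k
    by (rule Ck_on_inverse_function[OF V(1) assms(1) _ H N inv1 inv2 bound]) (use GS in auto)
  show thesis
  \<comment> \<open>Since \<open>H\<close> is \<open>P\<close> after \<open>F\<close>, the map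
    \<open>G\<close> after \<open>P\<close> undoes \<open>F\<close>. It is defined on an open subset
    of the ambient space, not just on the image of \<open>F\<close>.\<close>
  proof (rule that[of "P -` V" "G \<circ> P" U'])
    show o: "open (P -` V)"
      using V(1) blP by (simp add: linear_continuous_on open_vimage)
    show "smooth_on (P -` V) (G \<circ> P)"
      unfolding smooth_on_def o_def
      by (intro allI Ck_on_compose[OF o V(1) _ _ G] Ck_on_bounded_linear[OF o blP]) auto
    show "(G \<circ> P) ` (P -` V) \<subseteq> S" using GS by auto
    show "F x \<in> P -` V" "(G \<circ> P) (F x) = x" if "x \<in> U'" for x
      using hom that by (auto simp: homeomorphism_def H_def)
  qed (use U' U in auto)
qed

section \<open>Tangent vectors and coordinates\<close>

locale smooth_manifold =
  fixes A :: "('a::{t2_space, second_countable_topology}, 'e::euclidean_space) atlas"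
  assumes smooth_structure: "smooth_structure A"
begin

context
  fixes U \<phi>
  assumes c: "(U, \<phi>) \<in> A"
begin

lemma is_chart: "is_chart (U, \<phi>)"
  using c smooth_structure unfolding smooth_structure_def by blast

lemma chart_open: "open U" "open (\<phi> ` U)"
  using is_chart by (auto simp: is_chart_def)

lemma chart_homeomorphism: "homeomorphism U (\<phi> ` U) \<phi> (inv_into U \<phi>)"
  using is_chart by (auto simp: is_chart_def)

lemma chart_inv [simp]: "p \<in> U \<Longrightarrow> inv_into U \<phi> (\<phi> p) = p"
  using chart_homeomorphism by (auto simp: homeomorphism_def)

lemma chart_continuous: "continuous_on U \<phi>" "continuous_on (\<phi> ` U) (inv_into U \<phi>)"
  using chart_homeomorphism by (auto simp: homeomorphism_def)

lemma chart_image_open: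
  assumes "open V"
  shows "open (\<phi> ` (U \<inter> V))"
proof -
  have "\<phi> ` (U \<inter> V) = \<phi> ` U \<inter> inv_into U \<phi> -` V"
    by auto
  then show ?thesis
    using continuous_open_preimage[OF chart_continuous(2) chart_open(2) assms] by simp
qed

lemma chart_vimage_open: "open V \<Longrightarrow> open (U \<inter> \<phi> -` V)"
  using continuous_open_preimage[OF chart_continuous(1) chart_open(1)] by blast

lemma smooth_fun_chart: "smooth_fun A f \<Longrightarrow> smooth_on (\<phi> ` U) (f \<circ> inv_into U \<phi>)"
  using c by (auto simp: smooth_fun_def)

lemma smooth_fun_has_derivative:
  assumes "smooth_fun A f" "p \<in> U"
  shows "((f \<circ> inv_into U \<phi>) has_derivative frechet_derivative (f \<circ> inv_into U \<phi>) (at (\<phi> p))) (at (\<phi> p))"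
  using smooth_on_has_derivative[OF smooth_fun_chart] assms by blast

end

lemma chart_exists: obtains U \<phi> where "(U, \<phi>) \<in> A" "p \<in> U"
proof -
  have "p \<in> (\<Union>c\<in>A. fst c)"
    using smooth_structure by (simp add: smooth_structure_def)
  then show thesis using that by auto
qed

lemma transition_smooth:
  assumes "(U, \<phi>) \<in> A" "(W, \<theta>) \<in> A"
  shows "smooth_on (\<theta> ` (W \<inter> U)) (\<phi> \<circ> inv_into W \<theta>)"
  using smooth_structure assms unfolding smooth_structure_def compatible_charts_def
  by (metis (no_types, lifting) case_prod_conv)

text \<open>\<open>smooth_fun\<close> tests all charts of the atlas. One chart around each point
  suffices, because the transition maps are smooth and \<open>Ck_on\<close> is local.\<close>

lemma smooth_fun_local:
  assumes "\<And>p. \<exists>U \<phi> V. (U, \<phi>) \<in> A \<and> open V \<and> p \<in> U \<inter> V \<and>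
    smooth_on (\<phi> ` (U \<inter> V)) (f \<circ> inv_into U \<phi>)"
  shows "smooth_fun A f"
  unfolding smooth_fun_def
proof (intro ballI, clarify, unfold smooth_on_def, intro allI Ck_on_local)
  fix W \<theta> k x
  assume W: "(W, \<theta>) \<in> A" and "x \<in> \<theta> ` W"
  then obtain p where p: "p \<in> W" "x = \<theta> p" by blast
  obtain U \<phi> V where U: "(U, \<phi>) \<in> A" and V: "open V" "p \<in> U \<inter> V"
    and f: "smooth_on (\<phi> ` (U \<inter> V)) (f \<circ> inv_into U \<phi>)"
    using assms by blast
  let ?T = "\<theta> ` (W \<inter> (U \<inter> V))"
  have T: "open ?T"
    using chart_image_open[OF W] chart_open[OF U] V by blast
  have h: "(\<phi> \<circ> inv_into W \<theta>) ` ?T \<subseteq> \<phi> ` (U \<inter> V)"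
    using W by auto
  have "Ck_on k ?T (\<phi> \<circ> inv_into W \<theta>)"
    by (rule Ck_on_subset[OF smooth_onD[OF transition_smooth[OF U W]]]) auto
  then have "Ck_on k ?T (\<lambda>x. (f \<circ> inv_into U \<phi>) ((\<phi> \<circ> inv_into W \<theta>) x))"
    by (rule Ck_on_compose[OF T chart_image_open[OF U V(1)] h _ smooth_onD[OF f]])
  then have "Ck_on k ?T (f \<circ> inv_into W \<theta>)"
    by (rule Ck_on_transform[OF _ T]) (use U W in auto)
  moreover have "x \<in> ?T" using p V by auto
  ultimately show "\<exists>T. open T \<and> x \<in> T \<and> Ck_on k T (f \<circ> inv_into W \<theta>)"
    using T by blast
qed

lemma smooth_fun_const: "smooth_fun A (\<lambda>_. c)"
  unfolding smooth_fun_def smooth_on_def o_def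
  using chart_open(2) Ck_on_const by blast

lemma smooth_fun_add:
  assumes "smooth_fun A f" "smooth_fun A g"
  shows "smooth_fun A (\<lambda>x. f x + g x)"
proof -
  have "Ck_on k (\<phi> ` U) (\<lambda>x. (f \<circ> inv_into U \<phi>) x + (g \<circ> inv_into U \<phi>) x)" if "(U, \<phi>) \<in> A" for U \<phi> k
    by (intro Ck_on_add chart_open(2)[OF that] smooth_onD[OF smooth_fun_chart[OF that]] assms)
  then show ?thesis
    by (auto simp: smooth_fun_def smooth_on_def o_def)
qed

lemma smooth_fun_mult:
  assumes "smooth_fun A f" "smooth_fun A g"
  shows "smooth_fun A (\<lambda>x. f x * g x)"
proof -
  have "Ck_on k (\<phi> ` U) (\<lambda>x. (f \<circ> inv_into U \<phi>) x *\<^sub>R (g \<circ> inv_into U \<phi>) x)" if "(U, \<phi>) \<in> A" for U \<phi> k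
    by (intro Ck_on_scaleR chart_open(2)[OF that] smooth_onD[OF smooth_fun_chart[OF that]] assms)
  then show ?thesis
    by (auto simp: smooth_fun_def smooth_on_def o_def)
qed

lemma smooth_fun_diff:
  assumes "smooth_fun A f" "smooth_fun A g"
  shows "smooth_fun A (\<lambda>x. f x - g x)"
  using smooth_fun_add[OF assms(1) smooth_fun_mult[OF smooth_fun_const[of "-1"] assms(2)]] by simp

lemma smooth_fun_sum:
  assumes "\<And>i. i \<in> I \<Longrightarrow> smooth_fun A (f i)"
  shows "smooth_fun A (\<lambda>x. \<Sum>i\<in>I. f i x)"
  using assms
  by (induction I rule: infinite_finite_induct) (auto intro: smooth_fun_const smooth_fun_add)

text \<open>The set in the manifold that corresponds to \<open>K\<close> is compact and therefore
  closed, as the space is Hausdorff. A point outside \<open>U\<close> thus has a neighbourhood on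
  which the function is 0.\<close>

lemma smooth_fun_extend_zero:
  assumes c: "(U, \<phi>) \<in> A" and w: "smooth_on (\<phi> ` U) w" and K: "compact K" "K \<subseteq> \<phi> ` U"
    and 0: "\<And>x. x \<in> \<phi> ` U - K \<Longrightarrow> w x = 0"
  shows "smooth_fun A (\<lambda>p. if p \<in> U then w (\<phi> p) else 0)" (is "smooth_fun A ?f")
proof (rule smooth_fun_local)
  fix p
  show "\<exists>U \<phi> V. (U, \<phi>) \<in> A \<and> open V \<and> p \<in> U \<inter> V \<and> smooth_on (\<phi> ` (U \<inter> V)) (?f \<circ> inv_into U \<phi>)"
  proof (cases "p \<in> U")
    case True
    have "smooth_on (\<phi> ` U) (?f \<circ> inv_into U \<phi>)"
      by (rule smooth_on_transform[OF w chart_open(2)[OF c]]) (use c in auto)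
    then show ?thesis
      using True c by (intro exI[of _ U] exI[of _ \<phi>] exI[of _ UNIV]) simp
  next
    case False
    let ?V = "- inv_into U \<phi> ` K"
    have "compact (inv_into U \<phi> ` K)"
      by (rule compact_continuous_image[OF continuous_on_subset[OF chart_continuous(2)[OF c] K(2)] K(1)])
    then have V: "open ?V" by (simp add: compact_imp_closed open_Compl)
    have pV: "p \<in> ?V"
      using False K(2) c by auto
    have fV: "?f x = 0" if "x \<in> ?V" for x
    proof (cases "x \<in> U")
      case True
      then have "\<phi> x \<notin> K" using that c by (metis ComplD chart_inv image_eqI)
      then show ?thesis using 0[of "\<phi> x"] True by simp
    qed simp
    obtain W \<theta> where W: "(W, \<theta>) \<in> A" "p \<in> W" using chart_exists by blast
    have o: "open (\<theta> ` (W \<inter> ?V))" by (rule chart_image_open[OF W(1) V])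
    have "(\<lambda>_. 0) x = (?f \<circ> inv_into W \<theta>) x" if "x \<in> \<theta> ` (W \<inter> ?V)" for x
      using that fV W(1) by fastforce
    then have "Ck_on k (\<theta> ` (W \<inter> ?V)) (?f \<circ> inv_into W \<theta>)" for k
      using Ck_on_cong[OF o, of "\<lambda>_. 0" "?f \<circ> inv_into W \<theta>" k] Ck_on_const[OF o] by blast
    then show ?thesis
      using W V pV by (intro exI[of _ W] exI[of _ \<theta>] exI[of _ ?V]) (simp add: smooth_on_def)
  qed
qed

text \<open>The plateau \<open>V\<close> lies in the manifold, where functions and fields have to
  agree locally, while \<open>K\<close> lies in coordinates, where products are continued by
  zero.\<close>

lemma chart_bump:
  assumes c: "(U, \<phi>) \<in> A" and "p \<in> U" "open N" "p \<in> N"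
  obtains \<beta> :: "'e \<Rightarrow> real" and V K where "smooth_on UNIV \<beta>" "open V" "p \<in> V" "V \<subseteq> U \<inter> N"
    "compact K" "K \<subseteq> \<phi> ` (U \<inter> N)" "\<And>r. r \<in> V \<Longrightarrow> \<beta> (\<phi> r) = 1" "\<And>x. x \<notin> K \<Longrightarrow> \<beta> x = 0"
proof -
  obtain \<beta> :: "'e \<Rightarrow> real" and V K where b: "smooth_on UNIV \<beta>" "open V" "\<phi> p \<in> V" "V \<subseteq> K" "compact K"
    "K \<subseteq> \<phi> ` (U \<inter> N)" "\<And>x. x \<in> V \<Longrightarrow> \<beta> x = 1" "\<And>x. x \<notin> K \<Longrightarrow> \<beta> x = 0"
    using smooth_bump[OF chart_image_open[OF c assms(3)], of "\<phi> p"] assms by blast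
  have "r \<in> N" if r: "r \<in> U" "\<phi> r \<in> V" for r
  proof -
    have "\<phi> r \<in> \<phi> ` (U \<inter> N)" using r(2) b(4,6) by blast
    then obtain s where "s \<in> U" "s \<in> N" "\<phi> r = \<phi> s" by blast
    then show ?thesis using r(1) chart_inv[OF c] by metis
  qed
  then show thesis
    using that[of \<beta> "U \<inter> \<phi> -` V" K] b chart_vimage_open[OF c b(2)] assms(2) by auto
qed

lemma smooth_fun_cutoff:
  assumes c: "(U, \<phi>) \<in> A" and b: "smooth_on UNIV \<beta>" and K: "compact K" "K \<subseteq> S" "\<And>x. x \<notin> K \<Longrightarrow> \<beta> x = 0"
    and u: "smooth_on S u" and S: "open S" "S \<subseteq> \<phi> ` U"
  shows "smooth_fun A (\<lambda>p. if p \<in> U then \<beta> (\<phi> p) * u (\<phi> p) else 0)"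
proof -
  have "Ck_on k UNIV (\<lambda>x. \<beta> x *\<^sub>R u x)" for k
    by (rule Ck_on_cutoff[OF smooth_onD[OF u] S(1) smooth_onD[OF b] K])
  then have "smooth_on UNIV (\<lambda>x. \<beta> x * u x)"
    by (simp add: smooth_on_def)
  then have "smooth_on (\<phi> ` U) (\<lambda>x. \<beta> x * u x)"
    by (rule smooth_on_subset) simp
  then show ?thesis
    by (rule smooth_fun_extend_zero[OF c _ K(1)]) (use K S in auto)
qed

section \<open>Derivations at a point\<close>

context
  fixes p v
  assumes v: "v \<in> tangent A p"
begin

lemma tangent_not_smooth: "\<not> smooth_fun A f \<Longrightarrow> v f = 0"
  using v by (simp add: tangent_def)

lemma tangent_add: "smooth_fun A f \<Longrightarrow> smooth_fun A g \<Longrightarrow> v (\<lambda>x. f x + g x) = v f + v g"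
  using v by (simp add: tangent_def)

lemma tangent_cmult: "smooth_fun A f \<Longrightarrow> v (\<lambda>x. c * f x) = c * v f"
  using v by (simp add: tangent_def)

lemma tangent_mult: "smooth_fun A f \<Longrightarrow> smooth_fun A g \<Longrightarrow> v (\<lambda>x. f x * g x) = f p * v g + g p * v f"
  using v by (simp add: tangent_def)

text \<open>The Leibniz rule for 1 = 1 * 1 shows that the value on 1 equals twice itself.\<close>

lemma tangent_const: "v (\<lambda>_. c) = 0"
  using tangent_mult[OF smooth_fun_const smooth_fun_const, of 1 1]
    tangent_cmult[OF smooth_fun_const, of c 1] by simp

lemma tangent_diff: "smooth_fun A f \<Longrightarrow> smooth_fun A g \<Longrightarrow> v (\<lambda>x. f x - g x) = v f - v g"
  using tangent_add[OF _ smooth_fun_mult[OF smooth_fun_const], of f g "-1"]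
    tangent_cmult[of g "-1"] by simp

lemma tangent_sum:
  assumes "\<And>i. i \<in> I \<Longrightarrow> smooth_fun A (f i)"
  shows "v (\<lambda>x. \<Sum>i\<in>I. f i x) = (\<Sum>i\<in>I. v (f i))"
  using assms
  by (induction I rule: infinite_finite_induct) (auto simp: tangent_const tangent_add smooth_fun_sum)

text \<open>With a bump \<open>h\<close> supported in \<open>N\<close> and \<open>h p = 1\<close>,
  the product of \<open>f - g\<close> and \<open>h\<close> is 0 everywhere. As \<open>f - g\<close>
  vanishes at \<open>p\<close>, the Leibniz rule leaves only \<open>v f - v g\<close>.\<close>

lemma tangent_local:
  assumes f: "smooth_fun A f" and g: "smooth_fun A g" and N: "open N" "p \<in> N"
    and eq: "\<And>x. x \<in> N \<Longrightarrow> f x = g x"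
  shows "v f = v g"
proof -
  obtain U \<phi> where c: "(U, \<phi>) \<in> A" "p \<in> U" using chart_exists by blast
  obtain \<beta> :: "'e \<Rightarrow> real" and V K where b: "smooth_on UNIV \<beta>" "open V" "p \<in> V" "V \<subseteq> U \<inter> N"
    "compact K" "K \<subseteq> \<phi> ` (U \<inter> N)" "\<And>r. r \<in> V \<Longrightarrow> \<beta> (\<phi> r) = 1" "\<And>x. x \<notin> K \<Longrightarrow> \<beta> x = 0"
    by (rule chart_bump[OF c N]) blast
  define h where "h r = (if r \<in> U then \<beta> (\<phi> r) else 0)" for r
  have h: "smooth_fun A h"
    unfolding h_def
    by (rule smooth_fun_extend_zero[OF c(1) _ b(5)])
      (use b smooth_on_subset[OF b(1)] in auto)
  have "(f r - g r) * h r = 0" for r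
  proof (cases "r \<in> U \<and> \<phi> r \<in> K")
    case True
    then have "\<phi> r \<in> \<phi> ` (U \<inter> N)" using b(6) by blast
    then obtain s where "s \<in> U" "s \<in> N" "\<phi> r = \<phi> s" by blast
    then have "r \<in> N" using True chart_inv[OF c(1)] by metis
    then show ?thesis using eq by simp
  next
    case False
    then show ?thesis using b(8) by (auto simp: h_def)
  qed
  then have "v (\<lambda>r. (f r - g r) * h r) = 0"
    using tangent_const[of 0] by presburger
  moreover have "f p = g p" "h p = 1"
    using eq N b(3,7) c(2) by (auto simp: h_def)
  ultimately show ?thesis
    using tangent_mult[OF smooth_fun_diff[OF f g] h] tangent_diff[OF f g] by simp
qed

end

lemma zero_in_tangent: "0 \<in> tangent A p"
  by (simp add: tangent_def)

lemma subspace_tangent: "subspace (tangent A p)"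
  unfolding subspace_def
  by (auto simp: tangent_def scaleR_fun_def algebra_simps)

section \<open>Coordinate description of tangent vectors\<close>

text \<open>The tangent vector with components \<open>w\<close> in the chart. The value 0 on
  functions that are not smooth follows the convention built into \<open>tangent\<close>.\<close>

definition coord_vector :: "'a set \<Rightarrow> ('a \<Rightarrow> 'e) \<Rightarrow> 'a \<Rightarrow> 'e \<Rightarrow> 'a tvec"
  where "coord_vector U \<phi> p w = (\<lambda>f. if smooth_fun A f
    then frechet_derivative (f \<circ> inv_into U \<phi>) (at (\<phi> p)) w else 0)"

lemma linear_coord_vector:
  assumes "(U, \<phi>) \<in> A" "p \<in> U"
  shows "linear (coord_vector U \<phi> p)"
proof -
  have "linear (frechet_derivative (f \<circ> inv_into U \<phi>) (at (\<phi> p)))" if "smooth_fun A f" for f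
    using smooth_fun_has_derivative[OF assms(1) that assms(2)] has_derivative_linear by blast
  then show ?thesis
    by (intro linearI) (auto simp: coord_vector_def fun_eq_iff scaleR_fun_def linear_add linear_scale)
qed

lemma coord_vector_tangent:
  assumes "(U, \<phi>) \<in> A" "p \<in> U"
  shows "coord_vector U \<phi> p w \<in> tangent A p"
proof -
  note D = smooth_fun_has_derivative[OF assms(1) _ assms(2)]
  have "frechet_derivative ((\<lambda>x. f x + g x) \<circ> inv_into U \<phi>) (at (\<phi> p)) =
    (\<lambda>w. frechet_derivative (f \<circ> inv_into U \<phi>) (at (\<phi> p)) w + frechet_derivative (g \<circ> inv_into U \<phi>) (at (\<phi> p)) w)"
    if "smooth_fun A f" "smooth_fun A g" for f g
    by (rule sym, rule frechet_derivative_at) (use has_derivative_add[OF D D] that in \<open>simp add: o_def\<close>)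
  moreover have "frechet_derivative ((\<lambda>x. c * f x) \<circ> inv_into U \<phi>) (at (\<phi> p)) =
    (\<lambda>w. c * frechet_derivative (f \<circ> inv_into U \<phi>) (at (\<phi> p)) w)"
    if "smooth_fun A f" for f c
    by (rule sym, rule frechet_derivative_at) (use has_derivative_mult_right[OF D] that in \<open>simp add: o_def\<close>)
  moreover have "frechet_derivative ((\<lambda>x. f x * g x) \<circ> inv_into U \<phi>) (at (\<phi> p)) =
    (\<lambda>w. f p * frechet_derivative (g \<circ> inv_into U \<phi>) (at (\<phi> p)) w + frechet_derivative (f \<circ> inv_into U \<phi>) (at (\<phi> p)) w * g p)"
    if "smooth_fun A f" "smooth_fun A g" for f g
    by (rule sym, rule frechet_derivative_at)
      (use has_derivative_mult[OF D D] that assms in \<open>simp add: o_def\<close>)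
  ultimately show ?thesis
    by (simp add: tangent_def coord_vector_def smooth_fun_add smooth_fun_mult smooth_fun_const mult.commute)
qed

text \<open>Derivations accept only functions smooth on the whole manifold, so the coordinates are
  cut off and agree with the chart only on \<open>N\<close>.\<close>

lemma coordinate_functions:
  assumes c: "(U, \<phi>) \<in> A" "p \<in> U"
  obtains y :: "'e \<Rightarrow> 'a \<Rightarrow> real" and N where "\<And>i. smooth_fun A (y i)" "open N" "p \<in> N" "N \<subseteq> U"
    "\<And>i r. r \<in> N \<Longrightarrow> y i r = \<phi> r \<bullet> i"
proof -
  obtain \<beta> :: "'e \<Rightarrow> real" and V K where b: "smooth_on UNIV \<beta>" "open V" "p \<in> V" "V \<subseteq> U \<inter> UNIV"
    "compact K" "K \<subseteq> \<phi> ` (U \<inter> UNIV)" "\<And>r. r \<in> V \<Longrightarrow> \<beta> (\<phi> r) = 1" "\<And>x. x \<notin> K \<Longrightarrow> \<beta> x = 0"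
    by (rule chart_bump[OF c open_UNIV UNIV_I]) blast
  have s: "smooth_on (\<phi> ` U) (\<lambda>x. x \<bullet> i)" for i
    unfolding smooth_on_def
    by (intro allI Ck_on_bounded_linear chart_open(2)[OF c(1)] bounded_linear_inner_left)
  show thesis
  proof (rule that[of "\<lambda>i r. if r \<in> U then \<beta> (\<phi> r) * (\<phi> r \<bullet> i) else 0" V])
    show "smooth_fun A (\<lambda>r. if r \<in> U then \<beta> (\<phi> r) * (\<phi> r \<bullet> i) else 0)" for i
      by (rule smooth_fun_cutoff[OF c(1) b(1,5) _ b(8) s chart_open(2)[OF c(1)] subset_refl])
        (use b(6) in auto)
  qed (use b in auto)
qed

text \<open>Near \<open>p\<close>, Hadamard writes \<open>f\<close> as a constant plus a sum of
  products of \<open>y i r - y i p\<close> with smooth factors \<open>k i r\<close>. The first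
  factor vanishes at \<open>p\<close>, so the Leibniz rule leaves \<open>v (y i)\<close> times
  \<open>k i p\<close>. The functions \<open>y\<close> are a parameter, since the extension of
  vector fields needs one family \<open>y\<close> for all points of \<open>N\<close>.\<close>

lemma tangent_eq_coord_vector:
  assumes v: "v \<in> tangent A p" and c: "(U, \<phi>) \<in> A"
    and y: "\<And>i. smooth_fun A (y i)" and N: "open N" "p \<in> N" "N \<subseteq> U"
    and yN: "\<And>i r. r \<in> N \<Longrightarrow> y i r = \<phi> r \<bullet> i"
  shows "v = coord_vector U \<phi> p (\<Sum>i\<in>Basis. v (y i) *\<^sub>R i)"
proof
  fix f
  have p: "p \<in> U" using N by auto
  show "v f = coord_vector U \<phi> p (\<Sum>i\<in>Basis. v (y i) *\<^sub>R i) f"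
  proof (cases "smooth_fun A f")
    case f: True
    let ?F = "f \<circ> inv_into U \<phi>"
    obtain e where e: "e > 0" "ball (\<phi> p) e \<subseteq> \<phi> ` U"
      using chart_open(2)[OF c] p openE by blast
    let ?S = "ball (\<phi> p) e"
    have F: "smooth_on ?S ?F"
      by (rule smooth_on_subset[OF smooth_fun_chart[OF c f] e(2)])
    obtain h where h: "\<And>i. smooth_on ?S (h i)" "\<And>i. h i (\<phi> p) = frechet_derivative ?F (at (\<phi> p)) i"
      "\<And>x. x \<in> ?S \<Longrightarrow> ?F x = ?F (\<phi> p) + (\<Sum>i\<in>Basis. ((x - \<phi> p) \<bullet> i) * h i x)"
      using hadamard[OF open_ball convex_ball _ F, of "\<phi> p"] e(1) by auto
    \<comment> \<open>The bump must live where the \<open>y i\<close> are the coordinates and where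
      the Hadamard coefficients \<open>h i\<close> are smooth.\<close>
    let ?N = "N \<inter> (U \<inter> \<phi> -` ?S)"
    have oN: "open ?N" using chart_vimage_open[OF c open_ball] N(1) by blast
    have pN: "p \<in> ?N" using N p e(1) by simp
    obtain \<beta> :: "'e \<Rightarrow> real" and V K where b: "smooth_on UNIV \<beta>" "open V" "p \<in> V" "V \<subseteq> U \<inter> ?N"
      "compact K" "K \<subseteq> \<phi> ` (U \<inter> ?N)" "\<And>r. r \<in> V \<Longrightarrow> \<beta> (\<phi> r) = 1" "\<And>x. x \<notin> K \<Longrightarrow> \<beta> x = 0"
      by (rule chart_bump[OF c p oN pN]) blast
    define k where "k i r = (if r \<in> U then \<beta> (\<phi> r) * h i (\<phi> r) else 0)" for i r
    have k: "smooth_fun A (k i)" for i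
      unfolding k_def
      by (rule smooth_fun_cutoff[OF c b(1,5) _ b(8) h(1) open_ball e(2)]) (use b(6) in auto)
    have kp: "k i p = frechet_derivative ?F (at (\<phi> p)) i" for i
      using b(3,7) p h(2) by (simp add: k_def)
    let ?g = "\<lambda>r. f p + (\<Sum>i\<in>Basis. (y i r - y i p) * k i r)"
    have t: "smooth_fun A (\<lambda>r. (y i r - y i p) * k i r)" for i
      by (intro smooth_fun_mult smooth_fun_diff smooth_fun_const y k)
    have fg: "f r = ?g r" if "r \<in> V" for r
    proof -
      have r: "r \<in> U" "r \<in> N" "\<phi> r \<in> ?S" using that b(4) by auto
      have "k i r = h i (\<phi> r)" for i using b(7)[OF that] r by (simp add: k_def)
      then show ?thesis
        using h(3)[OF r(3)] c r p yN[OF r(2)] yN[OF N(2)] by (simp add: inner_diff_left)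
    qed
    have "v f = v ?g"
      by (rule tangent_local[OF v f _ b(2,3) fg])
        (intro smooth_fun_add smooth_fun_const smooth_fun_sum t)
    also have "\<dots> = (\<Sum>i\<in>Basis. v (\<lambda>r. (y i r - y i p) * k i r))"
      using tangent_add[OF v smooth_fun_const smooth_fun_sum[OF t], of "f p" "\<lambda>i. i" Basis]
        tangent_sum[OF v t, of "\<lambda>i. i" Basis] tangent_const[OF v] by simp
    also have "\<dots> = (\<Sum>i\<in>Basis. v (y i) * frechet_derivative ?F (at (\<phi> p)) i)"
      using tangent_mult[OF v smooth_fun_diff[OF y smooth_fun_const] k]
        tangent_diff[OF v y smooth_fun_const] tangent_const[OF v]
      by (simp add: kp mult.commute)
    also have "\<dots> = frechet_derivative ?F (at (\<phi> p)) (\<Sum>i\<in>Basis. v (y i) *\<^sub>R i)"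
      using has_derivative_linear[OF smooth_fun_has_derivative[OF c f p]]
      by (simp add: linear_sum linear_scale)
    finally show ?thesis using f by (simp add: coord_vector_def)
  next
    case False
    then show ?thesis using tangent_not_smooth[OF v] by (simp add: coord_vector_def)
  qed
qed

lemma tangent_eq_span:
  assumes c: "(U, \<phi>) \<in> A" "p \<in> U"
  shows "tangent A p = span (coord_vector U \<phi> p ` Basis)"
proof
  obtain y :: "'e \<Rightarrow> 'a \<Rightarrow> real" and N where y: "\<And>i. smooth_fun A (y i)" "open N" "p \<in> N" "N \<subseteq> U"
    "\<And>i r. r \<in> N \<Longrightarrow> y i r = \<phi> r \<bullet> i"
    by (rule coordinate_functions[OF c]) blast
  show "tangent A p \<subseteq> span (coord_vector U \<phi> p ` Basis)"
  proof
    fix v assume v: "v \<in> tangent A p"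
    have "v = (\<Sum>i\<in>Basis. v (y i) *\<^sub>R coord_vector U \<phi> p i)"
      using tangent_eq_coord_vector[OF v c(1) y(1-4) y(5)] linear_coord_vector[OF c]
      by (simp add: linear_sum linear_scale)
    then show "v \<in> span (coord_vector U \<phi> p ` Basis)"
      by (metis (no_types, lifting) image_eqI span_base span_scale span_sum)
  qed
  show "span (coord_vector U \<phi> p ` Basis) \<subseteq> tangent A p"
    by (rule span_minimal[OF _ subspace_tangent]) (use coord_vector_tangent[OF c] in auto)
qed

text \<open>Applied to \<open>f\<close>, the field is in coordinates the sum of the components of
  \<open>W\<close> times the partial derivatives of \<open>f\<close>, hence smooth, and it vanishes
  off the compact set \<open>K\<close>.\<close>

lemma chart_vector_field:
  assumes c: "(U, \<phi>) \<in> A" and W: "smooth_on (\<phi> ` U) W" and K: "compact K" "K \<subseteq> \<phi> ` U"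
    and 0: "\<And>x. x \<in> \<phi> ` U - K \<Longrightarrow> W x = 0"
  shows "(\<lambda>p. if p \<in> U then coord_vector U \<phi> p (W (\<phi> p)) else 0) \<in> vector_fields A"
proof -
  have "smooth_fun A (\<lambda>p. if p \<in> U then frechet_derivative (f \<circ> inv_into U \<phi>) (at (\<phi> p)) (W (\<phi> p)) else 0)"
    if f: "smooth_fun A f" for f
  proof (rule smooth_fun_extend_zero[OF c _ K])
    let ?D = "\<lambda>x. frechet_derivative (f \<circ> inv_into U \<phi>) (at x)"
    note F = smooth_fun_chart[OF c f]
    note o = chart_open(2)[OF c]
    have D: "((f \<circ> inv_into U \<phi>) has_derivative ?D x) (at x)" if "x \<in> \<phi> ` U" for x
      using smooth_on_has_derivative[OF F that] .
    have "Ck_on k (\<phi> ` U) (\<lambda>x. \<Sum>i\<in>Basis. (W x \<bullet> i) *\<^sub>R ?D x i)" for k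
      by (intro Ck_on_sum Ck_on_scaleR o smooth_onD[OF smooth_on_frechet_derivative[OF F]]
          Ck_on_bounded_linear_comp[OF o bounded_linear_inner_left smooth_onD[OF W]])
    then have "smooth_on (\<phi> ` U) (\<lambda>x. \<Sum>i\<in>Basis. (W x \<bullet> i) *\<^sub>R ?D x i)"
      unfolding smooth_on_def by blast
    then show "smooth_on (\<phi> ` U) (\<lambda>x. ?D x (W x))"
      by (rule smooth_on_transform[OF _ o]) (rule has_derivative_euclidean_expand[OF D, symmetric])
    show "?D x (W x) = 0" if "x \<in> \<phi> ` U - K" for x
      using 0[OF that] has_derivative_linear[OF D] that by (auto simp: linear_0)
  qed
  moreover have "(if p \<in> U then coord_vector U \<phi> p (W (\<phi> p)) else 0) f =
    (if p \<in> U then frechet_derivative (f \<circ> inv_into U \<phi>) (at (\<phi> p)) (W (\<phi> p)) else 0)"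
    if "smooth_fun A f" for f p
    using that by (simp add: coord_vector_def)
  ultimately show ?thesis
    using coord_vector_tangent[OF c] zero_in_tangent by (simp add: vector_fields_def)
qed

end

section \<open>Nondegenerate forms and immersions\<close>

text \<open>Serves both the tangent spaces with \<open>g\<close> and the screen spaces with the
  induced metric. All laws are relative to \<open>S\<close>, because a metric is unconstrained on
  arguments that are not tangent vectors.\<close>

locale nondegenerate_form =
  fixes S :: "'v::real_vector set" and b :: "'v \<Rightarrow> 'v \<Rightarrow> real"
  assumes finite_span: "\<exists>K. finite K \<and> S = span K"
    and sym: "u \<in> S \<Longrightarrow> v \<in> S \<Longrightarrow> b u v = b v u"
    and add: "u \<in> S \<Longrightarrow> v \<in> S \<Longrightarrow> w \<in> S \<Longrightarrow> b (u + v) w = b u w + b v w"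
    and scale: "u \<in> S \<Longrightarrow> w \<in> S \<Longrightarrow> b (c *\<^sub>R u) w = c * b u w"
    and nondegenerate: "u \<in> S \<Longrightarrow> (\<And>w. w \<in> S \<Longrightarrow> b u w = 0) \<Longrightarrow> u = 0"
begin

lemma subspace: "subspace S"
  using finite_span by auto

lemma diff:
  assumes "u \<in> S" "v \<in> S" "w \<in> S"
  shows "b (u - v) w = b u w - b v w"
proof -
  have "b (u + (-1) *\<^sub>R v) w = b u w + (-1) * b v w"
    using add[OF assms(1) subspace_scale[OF subspace assms(2), of "-1"] assms(3)]
      scale[OF assms(2,3), of "-1"] by simp
  then show ?thesis by simp
qed

lemma add_right:
  assumes "u \<in> S" "v \<in> S" "w \<in> S"
  shows "b w (u + v) = b w u + b w v"
  using add[OF assms] sym assms subspace_add[OF subspace] by simp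

lemma scale_right:
  assumes "u \<in> S" "w \<in> S"
  shows "b w (c *\<^sub>R u) = c * b w u"
  using scale[OF assms] sym assms subspace_scale[OF subspace] by simp

lemma eqI:
  assumes "u \<in> S" "v \<in> S" "\<And>w. w \<in> S \<Longrightarrow> b u w = b v w"
  shows "u = v"
  using nondegenerate[of "u - v"] diff[OF assms(1,2)] assms subspace_diff[OF subspace] by auto

text \<open>Riesz representation by counting dimensions. For a basis \<open>E\<close> of
  \<open>S\<close>, sending \<open>s\<close> to its pairings with \<open>E\<close> is injective by
  nondegeneracy, and its values lie in the span of the functions \<open>\<delta> e\<close>, of which
  there are at most \<open>card E\<close>. So it is onto that span, and a preimage of the values of
  \<open>l\<close> on \<open>E\<close> represents \<open>l\<close>.\<close>

lemma represent:
  assumes l_add: "\<And>u v. u \<in> S \<Longrightarrow> v \<in> S \<Longrightarrow> l (u + v) = l u + l v"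
    and l_scale: "\<And>c u. u \<in> S \<Longrightarrow> l (c *\<^sub>R u) = c * l u"
  shows "\<exists>s\<in>S. \<forall>w\<in>S. b s w = l w"
proof -
  obtain K where K: "finite K" "S = span K" using finite_span by blast
  obtain E where E: "E \<subseteq> K" "independent E" "K \<subseteq> span E"
    using maximal_independent_subset by blast
  have fE: "finite E" using E(1) K(1) finite_subset by blast
  have S: "S = span E"
    using K(2) E(1,3) span_mono span_minimal[OF E(3) subspace_span] by blast
  have ES: "e \<in> S" if "e \<in> E" for e using that S span_base by blast
  have ext: "f w = h w" if "w \<in> S" "\<And>e. e \<in> E \<Longrightarrow> f e = h e"
    "\<And>u v. u \<in> S \<Longrightarrow> v \<in> S \<Longrightarrow> f (u + v) = f u + f v" "\<And>c u. u \<in> S \<Longrightarrow> f (c *\<^sub>R u) = c * f u"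
    "\<And>u v. u \<in> S \<Longrightarrow> v \<in> S \<Longrightarrow> h (u + v) = h u + h v" "\<And>c u. u \<in> S \<Longrightarrow> h (c *\<^sub>R u) = c * h u"
    for f h :: "'v \<Rightarrow> real" and w
  proof -
    have 0: "f 0 = 0" "h 0 = 0"
      using that(4)[of 0 0] that(6)[of 0 0] subspace_0[OF subspace] by auto
    have "subspace {w \<in> S. f w = h w}"
      unfolding subspace_def using that(3-6) 0 subspace
      by (auto simp: subspace_0 subspace_add subspace_scale)
    moreover have "E \<subseteq> {w \<in> S. f w = h w}" using that(2) ES by auto
    ultimately have "span E \<subseteq> {w \<in> S. f w = h w}" by (rule span_minimal[rotated])
    then show ?thesis using that(1) S by auto
  qed
  define T where "T s = (\<lambda>e. if e \<in> E then b s e else 0)" for s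
  \<comment> \<open>\<open>T\<close> is additive only on \<open>S\<close>; \<open>T'\<close> is a
    globally linear map that agrees with it there.\<close>
  obtain T' where T': "linear T'" "\<And>e. e \<in> E \<Longrightarrow> T' e = T e"
    using linear_independent_extend[OF E(2)] by metis
  have TT: "T' s = T s" if "s \<in> S" for s
  proof
    fix e
    show "T' s e = T s e"
    proof (rule ext[OF that])
      show "T' (u + v) e = T' u e + T' v e" "T' (c *\<^sub>R u) e = c * T' u e" for u v c
        using linear_add[OF T'(1)] linear_scale[OF T'(1)] by (auto simp: scaleR_fun_def)
    qed (use T'(2) add scale ES in \<open>auto simp: T_def\<close>)
  qed
  have inj: "inj_on T' (span E)"
  proof -
    have "u = 0" if u: "u \<in> span E" "T' u = 0" for u
    proof (rule nondegenerate)
      show uS: "u \<in> S" using u S by simp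
      have e: "b u e = 0" if "e \<in> E" for e
      proof -
        have "T u e = 0" using fun_cong[OF TT[OF uS], of e] u(2) by simp
        then show ?thesis using that by (simp add: T_def)
      qed
      show "b u w = 0" if "w \<in> S" for w
        using that by (rule ext[of w "b u" "\<lambda>_. 0"]) (use e add_right scale_right uS in auto)
    qed
    then show ?thesis using T'(1) linear_inj_on_iff_eq_0[OF T'(1) subspace_span] by blast
  qed
  have indep: "independent (T' ` E)"
    using linear_independent_injective_image[OF T'(1) E(2) inj] .
  have cardT: "card (T' ` E) = card E"
    using card_image inj inj_on_subset span_superset by metis
  define \<delta> where "\<delta> e = (\<lambda>e'. if e' = e then 1 else 0 :: real)" for e :: 'v
  have span\<delta>: "f \<in> span (\<delta> ` E)" if "\<And>e. e \<notin> E \<Longrightarrow> f e = 0" for f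
  proof -
    have "f = (\<Sum>e\<in>E. f e *\<^sub>R \<delta> e)"
    proof
      fix x
      have "(\<Sum>e\<in>E. f e *\<^sub>R \<delta> e) x = (\<Sum>e\<in>E. f e * \<delta> e x)"
        using fE by (induction E) (auto simp: zero_fun_def scaleR_fun_def)
      also have "\<dots> = (\<Sum>e\<in>E. if e = x then f e else 0)"
        by (rule sum.cong) (auto simp: \<delta>_def)
      also have "\<dots> = f x" using fE that[of x] by auto
      finally show "f x = (\<Sum>e\<in>E. f e *\<^sub>R \<delta> e) x" ..
    qed
    then show ?thesis
      by (metis (no_types, lifting) image_eqI span_base span_scale span_sum)
  qed
  have sub: "T' ` E \<subseteq> span (\<delta> ` E)"
    using T'(2) span\<delta> by (auto simp: T_def)
  \<comment> \<open>Otherwise \<open>f\<close> together with the image of \<open>E\<close> would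
    form \<open>card E + 1\<close> independent vectors in a space spanned by at most
    \<open>card E\<close>.\<close>
  have "f \<in> span (T' ` E)" if f: "f \<in> span (\<delta> ` E)" for f
  proof (rule ccontr)
    assume nf: "f \<notin> span (T' ` E)"
    then have "independent (insert f (T' ` E))"
      using indep independent_insertI by blast
    then have "card (insert f (T' ` E)) \<le> card (\<delta> ` E)"
      using independent_span_bound[of "\<delta> ` E"] fE f sub by auto
    also have "\<dots> \<le> card E" by (rule card_image_le[OF fE])
    finally have "card (insert f (T' ` E)) \<le> card E" .
    moreover have "f \<notin> T' ` E" using nf span_base by metis
    ultimately show False
      using fE cardT by simp
  qed
  then have "(\<lambda>e. if e \<in> E then l e else 0) \<in> T' ` span E"
    using span\<delta>[of "\<lambda>e. if e \<in> E then l e else 0"] linear_span_image[OF T'(1)] by metis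
  then obtain s where s: "s \<in> S" "T' s = (\<lambda>e. if e \<in> E then l e else 0)"
    using S by auto
  have e: "b s e = l e" if "e \<in> E" for e
  proof -
    have "T s e = l e" using TT[OF s(1)] s(2) that by metis
    then show ?thesis using that by (simp add: T_def)
  qed
  have "b s w = l w" if "w \<in> S" for w
    using that by (rule ext) (use e add_right scale_right s(1) l_add l_scale in auto)
  then show ?thesis using s(1) by blast
qed

end

section \<open>Gradients with respect to a nondegenerate form\<close>

lemma gradient_eqI:
  assumes "nondegenerate_form (E p) (h p)" "v \<in> E p" "\<And>w. w \<in> E p \<Longrightarrow> h p v w = w \<psi>"
  shows "gradient E h \<psi> p = v"
  unfolding gradient_def
  by (rule the_equality) (use assms nondegenerate_form.eqI[OF assms(1)] in auto)

lemma gradient: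
  assumes "nondegenerate_form (E p) (h p)"
  shows "gradient E h \<psi> p \<in> E p \<and> (\<forall>w\<in>E p. h p (gradient E h \<psi> p) w = w \<psi>)"
proof -
  obtain v where "v \<in> E p" "\<forall>w\<in>E p. h p v w = w \<psi>"
    using nondegenerate_form.represent[OF assms, of "\<lambda>w. w \<psi>"] by (auto simp: scaleR_fun_def)
  then show ?thesis
    using gradient_eqI[of E p h v \<psi>, OF assms] by auto
qed

lemma (in smooth_manifold) nondegenerate_form_tangent:
  assumes "pseudo_riemannian A g"
  shows "nondegenerate_form (tangent A p) (g p)"
proof
  obtain U \<phi> where "(U, \<phi>) \<in> A" "p \<in> U" using chart_exists by blast
  then show "\<exists>K. finite K \<and> tangent A p = span K"
    using tangent_eq_span finite_Basis by blast
qed (use assms in \<open>auto simp: pseudo_riemannian_def\<close>)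

lemma linear_pushforward: "linear (pushforward A \<iota>)"
  by (intro linearI) (auto simp: pushforward_def fun_eq_iff scaleR_fun_def)

section \<open>Immersions and local extension of vector fields\<close>

locale immersed_manifold =
  A: smooth_manifold A + B: smooth_manifold B
  for A :: "('a::{t2_space, second_countable_topology}, 'e::euclidean_space) atlas"
    and B :: "('b::{t2_space, second_countable_topology}, 'h::euclidean_space) atlas" +
  fixes \<iota> :: "'b \<Rightarrow> 'a"
  assumes immersion: "immersion B A \<iota>"
begin

lemma vimage_open: "open U \<Longrightarrow> open (\<iota> -` U)"
  using immersion by (simp add: immersion_def smooth_map_def open_vimage)

lemma smooth_in_charts:
  "(U, \<phi>) \<in> A \<Longrightarrow> (V, \<theta>) \<in> B \<Longrightarrow> smooth_on (\<theta> ` (V \<inter> \<iota> -` U)) (\<phi> \<circ> \<iota> \<circ> inv_into V \<theta>)"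
  using immersion unfolding immersion_def smooth_map_def by blast

lemma smooth_fun_pullback:
  assumes f: "smooth_fun A f"
  shows "smooth_fun B (f \<circ> \<iota>)"
proof (rule B.smooth_fun_local)
  fix q
  obtain U \<phi> where U: "(U, \<phi>) \<in> A" "\<iota> q \<in> U" using A.chart_exists by blast
  obtain V \<theta> where V: "(V, \<theta>) \<in> B" "q \<in> V" using B.chart_exists by blast
  have o: "open (\<iota> -` U)" using A.chart_open[OF U(1)] vimage_open by blast
  let ?T = "\<theta> ` (V \<inter> \<iota> -` U)"
  have T: "open ?T" using B.chart_image_open[OF V(1) o] .
  have "Ck_on k ?T (\<lambda>x. (f \<circ> inv_into U \<phi>) ((\<phi> \<circ> \<iota> \<circ> inv_into V \<theta>) x))" for k
    by (rule Ck_on_compose[OF T A.chart_open(2)[OF U(1)] _ smooth_onD[OF smooth_in_charts[OF U(1) V(1)]]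
          smooth_onD[OF A.smooth_fun_chart[OF U(1) f]]])
      (use V in auto)
  then have "smooth_on ?T (\<lambda>x. (f \<circ> inv_into U \<phi>) ((\<phi> \<circ> \<iota> \<circ> inv_into V \<theta>) x))"
    by (simp add: smooth_on_def)
  then have "smooth_on ?T ((f \<circ> \<iota>) \<circ> inv_into V \<theta>)"
    by (rule smooth_on_transform[OF _ T]) (use U V in auto)
  then show "\<exists>V \<theta> N. (V, \<theta>) \<in> B \<and> open N \<and> q \<in> V \<inter> N \<and> smooth_on (\<theta> ` (V \<inter> N)) (f \<circ> \<iota> \<circ> inv_into V \<theta>)"
    using U V o by blast
qed

lemma pushforward_tangent:
  assumes v: "v \<in> tangent B q"
  shows "pushforward A \<iota> v \<in> tangent A (\<iota> q)"
  using B.tangent_add[OF v smooth_fun_pullback smooth_fun_pullback]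
    B.tangent_mult[OF v smooth_fun_pullback smooth_fun_pullback]
    B.tangent_cmult[OF v smooth_fun_pullback]
    A.smooth_fun_add A.smooth_fun_mult A.smooth_fun_mult[OF A.smooth_fun_const]
  by (simp add: tangent_def pushforward_def o_def)

text \<open>Translates the immersion property from derivations to coordinates. If \<open>w\<close>
  is in the kernel, the coordinate vector of \<open>w\<close> is pushed forward to 0, hence is 0,
  and applying it to cut-off coordinates recovers each component of \<open>w\<close>.\<close>

lemma inj_chart_derivative:
  assumes U: "(U, \<phi>) \<in> A" "\<iota> q \<in> U" and V: "(V, \<theta>) \<in> B" "q \<in> V"
  shows "inj (frechet_derivative (\<phi> \<circ> \<iota> \<circ> inv_into V \<theta>) (at (\<theta> q)))"
proof -
  let ?F = "\<phi> \<circ> \<iota> \<circ> inv_into V \<theta>"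
  let ?T = "\<theta> ` (V \<inter> \<iota> -` U)"
  have T: "open ?T"
    using B.chart_image_open[OF V(1) vimage_open] A.chart_open[OF U(1)] by blast
  have qT: "\<theta> q \<in> ?T" using U V by auto
  have F: "(?F has_derivative frechet_derivative ?F (at (\<theta> q))) (at (\<theta> q))"
    by (rule smooth_on_has_derivative[OF smooth_in_charts[OF U(1) V(1)] qT])
  have Fq: "?F (\<theta> q) = \<phi> (\<iota> q)" using V by simp
  have "w = 0" if w: "frechet_derivative ?F (at (\<theta> q)) w = 0" for w
  proof -
    let ?v = "B.coord_vector V \<theta> q w"
    have "?v (f \<circ> \<iota>) = 0" if f: "smooth_fun A f" for f
    proof -
      let ?G = "frechet_derivative (f \<circ> inv_into U \<phi>) (at (\<phi> (\<iota> q)))"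
      have G: "((f \<circ> inv_into U \<phi>) has_derivative ?G) (at (?F (\<theta> q)))"
        using A.smooth_fun_has_derivative[OF U(1) f U(2)] Fq by simp
      have "((f \<circ> \<iota> \<circ> inv_into V \<theta>) has_derivative (?G \<circ> frechet_derivative ?F (at (\<theta> q)))) (at (\<theta> q))"
        using diff_chain_at[OF F G] T qT
        by (rule has_derivative_transform_within_open) (use U V in auto)
      then have "frechet_derivative (f \<circ> \<iota> \<circ> inv_into V \<theta>) (at (\<theta> q)) = ?G \<circ> frechet_derivative ?F (at (\<theta> q))"
        by (rule frechet_derivative_at[symmetric])
      then show ?thesis
        using w smooth_fun_pullback[OF f] has_derivative_linear[OF G]
        by (simp add: B.coord_vector_def linear_0)
    qed
    then have "pushforward A \<iota> ?v = pushforward A \<iota> 0"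
      by (auto simp: pushforward_def)
    then have v0: "?v = 0"
      using immersion B.coord_vector_tangent[OF V] B.zero_in_tangent
      unfolding immersion_def by (blast dest: inj_onD)
    obtain y :: "'h \<Rightarrow> 'b \<Rightarrow> real" and N where y: "\<And>i. smooth_fun B (y i)" "open N" "q \<in> N" "N \<subseteq> V"
      "\<And>i r. r \<in> N \<Longrightarrow> y i r = \<theta> r \<bullet> i"
      by (rule B.coordinate_functions[OF V]) blast
    have "w \<bullet> i = 0" for i
    proof -
      have "((\<lambda>x. x \<bullet> i) has_derivative (\<lambda>x. x \<bullet> i)) (at (\<theta> q))"
        by (rule bounded_linear_imp_has_derivative[OF bounded_linear_inner_left])
      then have "((y i \<circ> inv_into V \<theta>) has_derivative (\<lambda>x. x \<bullet> i)) (at (\<theta> q))"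
        using B.chart_image_open[OF V(1) y(2)]
        by (rule has_derivative_transform_within_open) (use y V in auto)
      then have "frechet_derivative (y i \<circ> inv_into V \<theta>) (at (\<theta> q)) = (\<lambda>x. x \<bullet> i)"
        by (rule frechet_derivative_at[symmetric])
      moreover have "?v (y i) = 0" using v0 by simp
      ultimately show ?thesis
        using y(1) by (simp add: B.coord_vector_def)
    qed
    then show "w = 0" using inner_eq_zero_iff by blast
  qed
  then show ?thesis
    using has_derivative_linear[OF F] by (simp add: linear_injective_0)
qed

lemma extension_exists:
  assumes X: "X \<in> vector_fields B"
  shows "\<exists>Xe. extends_near A \<iota> q X Xe"
proof -
  obtain U \<phi> where U: "(U, \<phi>) \<in> A" "\<iota> q \<in> U" using A.chart_exists by blast
  obtain V \<theta> where V: "(V, \<theta>) \<in> B" "q \<in> V" using B.chart_exists by blast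
  obtain y :: "'e \<Rightarrow> 'a \<Rightarrow> real" and N where y: "\<And>i. smooth_fun A (y i)" "open N" "\<iota> q \<in> N" "N \<subseteq> U"
    "\<And>i r. r \<in> N \<Longrightarrow> y i r = \<phi> r \<bullet> i"
    by (rule A.coordinate_functions[OF U]) blast
  \<comment> \<open>The components of the pushed forward field. Reading them off with the global
    functions \<open>y i\<close> makes \<open>a\<close> smooth on all of \<open>V\<close>; they
    describe the field where \<open>\<iota> r \<in> N\<close>.\<close>
  define a where "a r = (\<Sum>i\<in>Basis. X r (y i \<circ> \<iota>) *\<^sub>R i)" for r
  have XB: "X r \<in> tangent B r" for r using X by (simp add: vector_fields_def)
  have push: "pushforward A \<iota> (X r) = A.coord_vector U \<phi> (\<iota> r) (a r)" if "\<iota> r \<in> N" for r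
    using A.tangent_eq_coord_vector[OF pushforward_tangent[OF XB[of r]] U(1) y(1,2) that y(4,5)]
    by (simp add: a_def pushforward_def y(1))
  have a: "smooth_on (\<theta> ` V) (\<lambda>x. a (inv_into V \<theta> x))"
  proof -
    have s: "smooth_on (\<theta> ` V) (\<lambda>x. X (inv_into V \<theta> x) (y i \<circ> \<iota>))" for i
      using B.smooth_fun_chart[OF V(1), of "\<lambda>r. X r (y i \<circ> \<iota>)"] X smooth_fun_pullback[OF y(1)]
      by (auto simp: vector_fields_def o_def)
    show ?thesis
      unfolding smooth_on_def a_def
      by (intro allI Ck_on_sum Ck_on_scaleR Ck_on_const B.chart_open(2)[OF V(1)] smooth_onD[OF s])
  qed
  let ?F = "\<phi> \<circ> \<iota> \<circ> inv_into V \<theta>"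
  let ?O = "\<theta> ` (V \<inter> \<iota> -` U)"
  have O: "open ?O"
    using B.chart_image_open[OF V(1) vimage_open] A.chart_open[OF U(1)] by blast
  have qO: "\<theta> q \<in> ?O" using U V by auto
  obtain T R W where T: "open T" "smooth_on T R" "R ` T \<subseteq> ?O" and W: "open W" "\<theta> q \<in> W" "W \<subseteq> ?O"
    and RF: "\<And>x. x \<in> W \<Longrightarrow> ?F x \<in> T" "\<And>x. x \<in> W \<Longrightarrow> R (?F x) = x"
    using smooth_immersion_left_inverse[OF O qO smooth_in_charts[OF U(1) V(1)]
        inj_chart_derivative[OF U V]] by blast
  let ?N = "U \<inter> \<phi> -` T"
  have oN: "open ?N" by (rule A.chart_vimage_open[OF U(1) T(1)])
  have qN: "\<iota> q \<in> ?N"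
    using U RF(1)[OF W(2)] V by simp
  obtain \<beta> :: "'e \<Rightarrow> real" and M K where b: "smooth_on UNIV \<beta>" "open M" "\<iota> q \<in> M" "M \<subseteq> U \<inter> ?N"
    "compact K" "K \<subseteq> \<phi> ` (U \<inter> ?N)" "\<And>r. r \<in> M \<Longrightarrow> \<beta> (\<phi> r) = 1" "\<And>x. x \<notin> K \<Longrightarrow> \<beta> x = 0"
    by (rule A.chart_bump[OF U oN qN]) blast
  \<comment> \<open>\<open>R\<close> takes ambient coordinates back to hypersurface coordinates, so
    the components become a function on an open set of the ambient chart.\<close>
  define Z where "Z x = \<beta> x *\<^sub>R a (inv_into V \<theta> (R x))" for x
  have aR: "Ck_on k T (\<lambda>x. a (inv_into V \<theta> (R x)))" for k
    by (rule Ck_on_compose[OF T(1) B.chart_open(2)[OF V(1)] _ smooth_onD[OF T(2)] smooth_onD[OF a]])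
      (use T(3) in auto)
  have "Ck_on k UNIV Z" for k
    unfolding Z_def
    by (rule Ck_on_cutoff[OF aR T(1) smooth_onD[OF b(1)] b(5) _ b(8)]) (use b(6) in auto)
  then have Z: "smooth_on (\<phi> ` U) Z"
    using smooth_on_subset[OF _ subset_UNIV, of Z] by (simp add: smooth_on_def)
  define Xe where "Xe p = (if p \<in> U then A.coord_vector U \<phi> p (Z (\<phi> p)) else 0)" for p
  have "Xe \<in> vector_fields A"
    unfolding Xe_def
    by (rule A.chart_vector_field[OF U(1) Z b(5)]) (use b(6,8) in \<open>auto simp: Z_def\<close>)
  \<comment> \<open>The neighbourhood collects three conditions: the bump is 1 on \<open>M\<close>,
    the components are valid on \<open>N\<close>, and \<open>R\<close> inverts the immersion on
    \<open>W\<close>. It is taken in the hypersurface, so other sheets of a non-injective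
    \<open>\<iota>\<close> do not interfere.\<close>
  moreover have "Xe (\<iota> r) = pushforward A \<iota> (X r)" if r: "r \<in> \<iota> -` (M \<inter> N) \<inter> (V \<inter> \<theta> -` W)" for r
  proof -
    have "?F (\<theta> r) = \<phi> (\<iota> r)" using r V(1) by simp
    then have "R (\<phi> (\<iota> r)) = \<theta> r" using RF(2)[of "\<theta> r"] r by simp
    then have "Z (\<phi> (\<iota> r)) = a r" using r b(7) V(1) by (simp add: Z_def)
    then show ?thesis using push[of r] r y(4) by (auto simp: Xe_def)
  qed
  moreover have "open (\<iota> -` (M \<inter> N) \<inter> (V \<inter> \<theta> -` W))"
    using vimage_open[of "M \<inter> N"] b(2) y(2) B.chart_vimage_open[OF V(1) W(1)] by blast
  moreover have "q \<in> \<iota> -` (M \<inter> N) \<inter> (V \<inter> \<theta> -` W)"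
    using b(3) y(3) V(2) W(2) by simp
  ultimately show ?thesis
    unfolding extends_near_def by blast
qed

end

section \<open>Restriction of the structure to the screen distribution\<close>

locale screened_hypersurface = immersed_manifold A B \<iota>
  for A :: "('a::{t2_space, second_countable_topology}, 'e::euclidean_space) atlas"
    and B :: "('b::{t2_space, second_countable_topology}, 'h::euclidean_space) atlas"
    and \<iota> :: "'b \<Rightarrow> 'a" +
  fixes g :: "'a metric" and S :: "'b \<Rightarrow> 'b tvec set"
  assumes metric: "pseudo_riemannian A g" and screen: "screen_distribution B A g \<iota> S"
begin

sublocale tangent: nondegenerate_form "tangent A p" "g p" for p
  by (rule A.nondegenerate_form_tangent[OF metric])

lemma screen_subset:
  assumes "v \<in> S q"
  shows "v \<in> tangent B q"
proof -
  \<comment> \<open>A screen vector is decomposed with radical part 0.\<close>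
  have "0 \<in> radical B (induced_metric A \<iota> g) q"
    using screen unfolding screen_distribution_def by blast
  then have "v + 0 \<in> {s + r |s r. s \<in> S q \<and> r \<in> radical B (induced_metric A \<iota> g) q}"
    using assms by blast
  then show ?thesis
    using screen unfolding screen_distribution_def by simp
qed

lemma screen_pushforward: "v \<in> S q \<Longrightarrow> pushforward A \<iota> v \<in> tangent A (\<iota> q)"
  using screen_subset pushforward_tangent by blast

text \<open>A vector of \<open>S q\<close> orthogonal to \<open>S q\<close> is also orthogonal to
  the radical, hence to the whole tangent space. It therefore lies in the radical, which meets
  \<open>S q\<close> only in 0.\<close>

sublocale screen: nondegenerate_form "S q" "induced_metric A \<iota> g q" for q
proof
  show "\<exists>K. finite K \<and> S q = span K"
    using screen unfolding screen_distribution_def smooth_distribution_def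
    by (metis finite_imageI finite_lessThan)
next
  fix u assume u: "u \<in> S q" "\<And>w. w \<in> S q \<Longrightarrow> induced_metric A \<iota> g q u w = 0"
  have "induced_metric A \<iota> g q u w = 0" if "w \<in> tangent B q" for w
  proof -
    obtain s r where w: "w = s + r" "s \<in> S q" "r \<in> radical B (induced_metric A \<iota> g) q"
      using screen \<open>w \<in> tangent B q\<close> unfolding screen_distribution_def by blast
    have r: "r \<in> tangent B q" "induced_metric A \<iota> g q r u = 0"
      using w(3) screen_subset[OF u(1)] by (auto simp: radical_def)
    have "induced_metric A \<iota> g q u w = induced_metric A \<iota> g q u s + induced_metric A \<iota> g q u r"
      using tangent.add_right[OF screen_pushforward[OF w(2)] pushforward_tangent[OF r(1)] screen_pushforward[OF u(1)]]
      by (simp add: induced_metric_def w(1) linear_add[OF linear_pushforward])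
    also have "\<dots> = 0"
      using u(2)[OF w(2)] r(2)
        tangent.sym[OF screen_pushforward[OF u(1)] pushforward_tangent[OF r(1)]]
      by (simp add: induced_metric_def)
    finally show ?thesis .
  qed
  then have "u \<in> radical B (induced_metric A \<iota> g) q"
    using screen_subset[OF u(1)] by (simp add: radical_def)
  then show "u = 0"
    using screen u(1) unfolding screen_distribution_def by blast
qed (simp_all add: induced_metric_def linear_add[OF linear_pushforward] linear_scale[OF linear_pushforward]
    tangent.sym tangent.add tangent.scale screen_pushforward)

text \<open>Replaces the decomposition in \<open>screen_component\<close> by a duality condition:
  the equation says that the remainder is in \<open>screen_perp\<close>, and nondegeneracy on
  \<open>S q\<close> gives uniqueness. The algebraic rules below reduce to it.\<close>

lemma screen_component_eqI:
  assumes u: "u \<in> tangent A (\<iota> q)" and s: "s \<in> S q"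
    and eq: "\<And>w. w \<in> S q \<Longrightarrow> induced_metric A \<iota> g q s w = g (\<iota> q) u (pushforward A \<iota> w)"
  shows "screen_component A g \<iota> S q u = s"
  unfolding screen_component_def
proof (rule the_equality, intro conjI s bexI)
  show "u = pushforward A \<iota> s + (u - pushforward A \<iota> s)" by simp
  show "u - pushforward A \<iota> s \<in> screen_perp A g \<iota> S q"
    using subspace_diff[OF A.subspace_tangent u screen_pushforward[OF s]]
      tangent.diff[OF u screen_pushforward[OF s] screen_pushforward] eq
    by (simp add: screen_perp_def induced_metric_def)
next
  fix r assume r: "r \<in> S q \<and> (\<exists>t\<in>screen_perp A g \<iota> S q. u = pushforward A \<iota> r + t)"
  then obtain t where t: "t \<in> screen_perp A g \<iota> S q" "u = pushforward A \<iota> r + t" by blast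
  show "r = s"
  proof (rule screen.eqI)
    fix w assume w: "w \<in> S q"
    have "g (\<iota> q) u (pushforward A \<iota> w) = induced_metric A \<iota> g q r w + g (\<iota> q) t (pushforward A \<iota> w)"
      using tangent.add[OF screen_pushforward[of r] _ screen_pushforward[OF w], of t] t r
      by (simp add: screen_perp_def induced_metric_def)
    then show "induced_metric A \<iota> g q r w = induced_metric A \<iota> g q s w"
      using eq[OF w] t(1) w by (simp add: screen_perp_def)
  qed (use r s in auto)
qed

lemma screen_component:
  assumes u: "u \<in> tangent A (\<iota> q)"
  shows "screen_component A g \<iota> S q u \<in> S q"
    and "w \<in> S q \<Longrightarrow> induced_metric A \<iota> g q (screen_component A g \<iota> S q u) w = g (\<iota> q) u (pushforward A \<iota> w)"
proof -
  have "\<exists>s\<in>S q. \<forall>w\<in>S q. induced_metric A \<iota> g q s w = g (\<iota> q) u (pushforward A \<iota> w)"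
    by (rule screen.represent)
      (simp_all add: linear_add[OF linear_pushforward] linear_scale[OF linear_pushforward]
        tangent.add_right tangent.scale_right screen_pushforward u)
  then obtain s where "s \<in> S q" "\<forall>w\<in>S q. induced_metric A \<iota> g q s w = g (\<iota> q) u (pushforward A \<iota> w)"
    by blast
  then show "screen_component A g \<iota> S q u \<in> S q"
    and "w \<in> S q \<Longrightarrow> induced_metric A \<iota> g q (screen_component A g \<iota> S q u) w = g (\<iota> q) u (pushforward A \<iota> w)"
    using screen_component_eqI[OF u] by auto
qed

lemma screen_component_add:
  assumes "u \<in> tangent A (\<iota> q)" "v \<in> tangent A (\<iota> q)"
  shows "screen_component A g \<iota> S q (u + v) = screen_component A g \<iota> S q u + screen_component A g \<iota> S q v"
  using screen_component assms
  by (intro screen_component_eqI subspace_add[OF A.subspace_tangent] subspace_add[OF screen.subspace])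
    (simp_all add: screen.add tangent.add screen_pushforward)

lemma screen_component_scale:
  assumes "u \<in> tangent A (\<iota> q)"
  shows "screen_component A g \<iota> S q (c *\<^sub>R u) = c *\<^sub>R screen_component A g \<iota> S q u"
  using screen_component assms
  by (intro screen_component_eqI subspace_scale[OF A.subspace_tangent] subspace_scale[OF screen.subspace])
    (simp_all add: screen.scale tangent.scale screen_pushforward)

lemma screen_component_diff:
  assumes "u \<in> tangent A (\<iota> q)" "v \<in> tangent A (\<iota> q)"
  shows "screen_component A g \<iota> S q (u - v) = screen_component A g \<iota> S q u - screen_component A g \<iota> S q v"
  using screen_component_add[OF assms(1) subspace_scale[OF A.subspace_tangent assms(2), of "-1"]]
    screen_component_scale[OF assms(2), of "-1"] by simp

lemma screen_component_pushforward:
  "s \<in> S q \<Longrightarrow> screen_component A g \<iota> S q (pushforward A \<iota> s) = s"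
  by (intro screen_component_eqI screen_pushforward) (auto simp: induced_metric_def)

text \<open>Both sides represent the same functional on \<open>S q\<close>, since a pushed forward
  \<open>w\<close> differentiates \<open>\<psi>\<close> as \<open>w\<close> differentiates its
  pullback. Smoothness of \<open>\<psi>\<close> selects the proper branch of
  \<open>pushforward\<close>.\<close>

lemma screen_component_gradient:
  assumes "smooth_fun A \<psi>"
  shows "screen_component A g \<iota> S q (gradient (tangent A) g \<psi> (\<iota> q)) =
    gradient S (induced_metric A \<iota> g) (\<psi> \<circ> \<iota>) q"
proof (rule screen_component_eqI)
  note G = gradient[of "tangent A" "\<iota> q" g \<psi>, OF tangent.nondegenerate_form_axioms]
  note G' = gradient[of S q "induced_metric A \<iota> g" "\<psi> \<circ> \<iota>", OF screen.nondegenerate_form_axioms]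
  show "gradient (tangent A) g \<psi> (\<iota> q) \<in> tangent A (\<iota> q)" using G by blast
  show "gradient S (induced_metric A \<iota> g) (\<psi> \<circ> \<iota>) q \<in> S q" using G' by blast
  fix w assume w: "w \<in> S q"
  have "g (\<iota> q) (gradient (tangent A) g \<psi> (\<iota> q)) (pushforward A \<iota> w) = pushforward A \<iota> w \<psi>"
    using G screen_pushforward[OF w] by blast
  also have "\<dots> = w (\<psi> \<circ> \<iota>)"
    using assms by (simp add: pushforward_def)
  finally show "induced_metric A \<iota> g q (gradient S (induced_metric A \<iota> g) (\<psi> \<circ> \<iota>) q) w =
      g (\<iota> q) (gradient (tangent A) g \<psi> (\<iota> q)) (pushforward A \<iota> w)"
    using G' w by simp
qed

text \<open>The metric enters \<open>screen_component\<close> only through orthogonality, which a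
  nonzero factor preserves.\<close>

lemma screen_component_conformal:
  assumes "c \<noteq> 0" "\<And>v w. v \<in> tangent A (\<iota> q) \<Longrightarrow> w \<in> tangent A (\<iota> q) \<Longrightarrow> g2 (\<iota> q) v w = c * g (\<iota> q) v w"
  shows "screen_component A g2 \<iota> S q = screen_component A g \<iota> S q"
proof -
  have "screen_perp A g2 \<iota> S q = screen_perp A g \<iota> S q"
    using assms screen_pushforward by (auto simp: screen_perp_def)
  then show ?thesis
    by (simp add: screen_component_def fun_eq_iff)
qed

lemma conf_proj_equiv_induced_structure:
  assumes D: "affine_connection A D"
    and equiv: "conf_proj_equiv A (tangent A) (g, \<eta>, D) (g2, \<eta>2, D2)"
  shows "conf_proj_equiv B S (induced_structure A \<iota> S (g, \<eta>, D)) (induced_structure A \<iota> S (g2, \<eta>2, D2))"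
proof -
  obtain \<phi> \<psi> where \<eta>: "\<And>p v. v \<in> tangent A p \<Longrightarrow> \<eta>2 p v = \<eta> p v"
    and smooth: "smooth_fun A \<phi>" "smooth_fun A \<psi>"
    and g2: "\<And>p v w. v \<in> tangent A p \<Longrightarrow> w \<in> tangent A p \<Longrightarrow> g2 p v w = exp (\<phi> p + \<psi> p) * g p v w"
    and D2: "\<And>X Y p. X \<in> sections A (tangent A) \<Longrightarrow> Y \<in> sections A (tangent A) \<Longrightarrow>
      D2 X Y p = D X Y p + X p \<phi> *\<^sub>R Y p + Y p \<phi> *\<^sub>R X p - g p (X p) (Y p) *\<^sub>R gradient (tangent A) g \<psi> p"
    using equiv unfolding conf_proj_equiv_def by auto
  have sections: "sections A (tangent A) = vector_fields A"
    by (auto simp: sections_def vector_fields_def)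
  have "induced_connection A \<iota> S g2 D2 X Y q = induced_connection A \<iota> S g D X Y q
      + X q (\<phi> \<circ> \<iota>) *\<^sub>R Y q + Y q (\<phi> \<circ> \<iota>) *\<^sub>R X q
      - induced_metric A \<iota> g q (X q) (Y q) *\<^sub>R gradient S (induced_metric A \<iota> g) (\<psi> \<circ> \<iota>) q"
    if X: "X \<in> sections B S" and Y: "Y \<in> sections B S" for X Y q
  proof -
    define Xe where "Xe = (SOME Xe. extends_near A \<iota> q X Xe)"
    define Ye where "Ye = (SOME Ye. extends_near A \<iota> q Y Ye)"
    \<comment> \<open>Existence of an extension is what gives these choices their meaning; without
      it the hypotheses on \<open>D\<close> and \<open>D2\<close> would say nothing about
      them.\<close>
    have ext: "extends_near A \<iota> q Z (SOME Ze. extends_near A \<iota> q Z Ze)" if "Z \<in> sections B S" for Z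
    proof -
      have "Z \<in> vector_fields B" using that by (simp add: sections_def)
      then show ?thesis by (rule someI_ex[OF extension_exists])
    qed
    have Xe: "extends_near A \<iota> q X Xe" and Ye: "extends_near A \<iota> q Y Ye"
      unfolding Xe_def Ye_def using ext X Y by blast+
    have vf: "Xe \<in> vector_fields A" "Ye \<in> vector_fields A"
      using Xe Ye by (auto simp: extends_near_def)
    have at_q: "Xe (\<iota> q) = pushforward A \<iota> (X q)" "Ye (\<iota> q) = pushforward A \<iota> (Y q)"
      using Xe Ye by (auto simp: extends_near_def)
    have XY: "X q \<in> S q" "Y q \<in> S q" using X Y by (auto simp: sections_def)
    \<comment> \<open>The rules for the screen component apply to tangent vectors only.\<close>
    have d: "D Xe Ye (\<iota> q) \<in> tangent A (\<iota> q)"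
      using D vf by (auto simp: affine_connection_def vector_fields_def)
    have G: "gradient (tangent A) g \<psi> (\<iota> q) \<in> tangent A (\<iota> q)"
      using gradient[of "tangent A" "\<iota> q" g \<psi>, OF tangent.nondegenerate_form_axioms] by blast
    have "induced_connection A \<iota> S g2 D2 X Y q = screen_component A g \<iota> S q (D2 Xe Ye (\<iota> q))"
      using screen_component_conformal[of "exp (\<phi> (\<iota> q) + \<psi> (\<iota> q))" q g2] g2
      by (simp add: induced_connection_def derivative_along_def Xe_def Ye_def)
    also have "\<dots> = screen_component A g \<iota> S q (D Xe Ye (\<iota> q) + X q (\<phi> \<circ> \<iota>) *\<^sub>R pushforward A \<iota> (Y q)
      + Y q (\<phi> \<circ> \<iota>) *\<^sub>R pushforward A \<iota> (X q)
      - induced_metric A \<iota> g q (X q) (Y q) *\<^sub>R gradient (tangent A) g \<psi> (\<iota> q))"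
      using smooth(1) vf D2[of Xe Ye "\<iota> q"]
      by (simp add: sections at_q induced_metric_def) (simp add: pushforward_def)
    also have "\<dots> = screen_component A g \<iota> S q (D Xe Ye (\<iota> q)) + X q (\<phi> \<circ> \<iota>) *\<^sub>R Y q + Y q (\<phi> \<circ> \<iota>) *\<^sub>R X q
      - induced_metric A \<iota> g q (X q) (Y q) *\<^sub>R gradient S (induced_metric A \<iota> g) (\<psi> \<circ> \<iota>) q"
      by (simp add: screen_component_add screen_component_diff screen_component_scale d G XY
          subspace_add[OF A.subspace_tangent] subspace_scale[OF A.subspace_tangent]
          screen_pushforward screen_component_pushforward screen_component_gradient smooth)
    finally show ?thesis
      by (simp add: induced_connection_def derivative_along_def Xe_def Ye_def)
  qed
  moreover have "induced_metric A \<iota> g2 q v w = exp ((\<phi> \<circ> \<iota>) q + (\<psi> \<circ> \<iota>) q) * induced_metric A \<iota> g q v w"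
    if "v \<in> S q" "w \<in> S q" for q v w
    using g2 that screen_pushforward by (simp add: induced_metric_def)
  moreover have "induced_form A \<iota> \<eta>2 q v = induced_form A \<iota> \<eta> q v" if "v \<in> S q" for q v
    using \<eta> that screen_pushforward by (simp add: induced_form_def)
  ultimately show ?thesis
    using smooth_fun_pullback[OF smooth(1)] smooth_fun_pullback[OF smooth(2)]
    unfolding conf_proj_equiv_def induced_structure_def prod.case by blast
qed

end

theorem proposition5p4:
  fixes A :: "('a::{t2_space, second_countable_topology}, 'e::euclidean_space) atlas"
    and B :: "('b::{t2_space, second_countable_topology}, 'h::euclidean_space) atlas"
    and \<iota> :: "'b \<Rightarrow> 'a"
    and S :: "'b \<Rightarrow> 'b tvec set"
    and g g2 :: "'a metric" and \<eta> :: "'a form" and D D2 :: "'a connection"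
    and n :: nat
  assumes "smooth_structure A" and "DIM('e) = n + 2"
    and "smooth_structure B"
    and "pseudo_riemannian A g"
    and "\<forall>p. 0 < negative_index A g p \<and> negative_index A g p < n + 2"
    and "lightlike_hypersurface B A g \<iota>"
    and "screen_distribution B A g \<iota> S"
    and "integrable_distribution B S"
    and "SWMT A (g, \<eta>, D)" and "SWMT A (g2, \<eta>, D2)"
    and "conf_proj_equiv A (tangent A) (g, \<eta>, D) (g2, \<eta>, D2)"
  shows "conf_proj_equiv B S (induced_structure A \<iota> S (g, \<eta>, D))
           (induced_structure A \<iota> S (g2, \<eta>, D2))"
proof -
  interpret screened_hypersurface A B \<iota> g S
    by unfold_locales
      (use assms(1,3,4,6,7) in \<open>auto simp: lightlike_hypersurface_def smooth_hypersurface_def\<close>)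
  show ?thesis
    by (rule conf_proj_equiv_induced_structure[OF _ assms(11)])
      (use assms(9) in \<open>simp add: SWMT_def\<close>)
qed

end
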